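(* For every integer $d\geq 2$ there exist $\varepsilon=\varepsilon(d)>0$ and $\eta=\eta(d)>0$ such that every distance-regular graph $X$ of diameter $d$ and degree $k$ satisfies at least one of: (1) there is $0\le i\le d-1$ with $b_i\geq\varepsilon k$ and $c_{i+1}\geq\varepsilon k$; (2) the zero-weight spectral radius $\xi$ of $X$ satisfies $\xi\leq k(1-\eta)$. Moreover, one may take $\eta=\frac14 d^{-(1+\log_2 d)}$ and $\varepsilon=200^{-(d+1)}d^{-(d+1)(\log_2 d+3)}$.
   Context: A connected graph $X$ of diameter $d$ is distance-regular if there are integers $a_i,b_i,c_i$ ($0\le i\le d$) such that for all vertices $v,w$ with $\mathrm{dist}(v,w)=i$, $w$ has exactly $c_i$ neighbours at distance $i-1$, $a_i$ at distance $i$, $b_i$ at distance $i+1$ from $v$; $X$ is $k$-regular with $k=b_0$. For a $k$-regular graph with adjacency eigenvalues $k=\xi_1\ge\dots\ge\xi_n$, the zero-weight spectral radius is $\xi=\max\{|\xi_i|:2\le i\le n\}$. *)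

theory Defs
  imports "Jordan_Normal_Form.Char_Poly" "HOL-Computational_Algebra.Polynomial"
begin

definition simple_graph :: "nat \<Rightarrow> (nat \<Rightarrow> nat \<Rightarrow> bool) \<Rightarrow> bool" where
  "simple_graph n E \<longleftrightarrow> (\<forall>u v. E u v \<longrightarrow> u < n \<and> v < n) \<and> (\<forall>u v. E u v \<longrightarrow> E v u) \<and> (\<forall>u. \<not> E u u)"

definition gdist :: "(nat \<Rightarrow> nat \<Rightarrow> bool) \<Rightarrow> nat \<Rightarrow> nat \<Rightarrow> nat" where
  "gdist E v w = (LEAST m. (E ^^ m) v w)"

definition connected_graph :: "nat \<Rightarrow> (nat \<Rightarrow> nat \<Rightarrow> bool) \<Rightarrow> bool" where
  "connected_graph n E \<longleftrightarrow> n \<ge> 1 \<and> (\<forall>v<n. \<forall>w<n. \<exists>m. (E ^^ m) v w)"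

definition has_diameter :: "nat \<Rightarrow> (nat \<Rightarrow> nat \<Rightarrow> bool) \<Rightarrow> nat \<Rightarrow> bool" where
  "has_diameter n E d \<longleftrightarrow> (\<forall>v<n. \<forall>w<n. gdist E v w \<le> d) \<and> (\<exists>v<n. \<exists>w<n. gdist E v w = d)"

text \<open>Distance-regular graph of diameter d with intersection numbers a, b, c
  (c i only meaningful for i \<ge> 1; b d = 0 is forced).\<close>
definition distance_regular ::
  "nat \<Rightarrow> (nat \<Rightarrow> nat \<Rightarrow> bool) \<Rightarrow> nat \<Rightarrow> (nat \<Rightarrow> nat) \<Rightarrow> (nat \<Rightarrow> nat) \<Rightarrow> (nat \<Rightarrow> nat) \<Rightarrow> bool" where
  "distance_regular n E d a b c \<longleftrightarrow>
     simple_graph n E \<and> connected_graph n E \<and> has_diameter n E d \<and>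
     (\<forall>i\<le>d. \<forall>v<n. \<forall>w<n. gdist E v w = i \<longrightarrow>
        (i \<ge> 1 \<longrightarrow> card {u. u < n \<and> E w u \<and> gdist E v u + 1 = i} = c i) \<and>
        card {u. u < n \<and> E w u \<and> gdist E v u = i} = a i \<and>
        card {u. u < n \<and> E w u \<and> gdist E v u = i + 1} = b i)"

definition adj_matrix :: "nat \<Rightarrow> (nat \<Rightarrow> nat \<Rightarrow> bool) \<Rightarrow> real mat" where
  "adj_matrix n E = mat n n (\<lambda>(i, j). if E i j then 1 else 0)"

text \<open>Adjacency eigenvalues with multiplicity (roots of the characteristic polynomial;
  the adjacency matrix is real symmetric, so all roots are real).\<close>
definition adj_eigenvalues :: "nat \<Rightarrow> (nat \<Rightarrow> nat \<Rightarrow> bool) \<Rightarrow> real multiset" where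
  "adj_eigenvalues n E = proots (char_poly (adj_matrix n E))"

definition zero_weight_spectral_radius :: "nat \<Rightarrow> (nat \<Rightarrow> nat \<Rightarrow> bool) \<Rightarrow> nat \<Rightarrow> real" where
  "zero_weight_spectral_radius n E k =
     Max (abs ` set_mset (adj_eigenvalues n E - {# real k #}))"

end

theory Submission
  imports Defs
begin

text \<open>Suppose that no index satisfies alternative (1), and let \<open>t\<close> be the first index at which
  \<open>b t / c (t + 1)\<close> is no longer large, so that \<open>c t\<close> and \<open>b t\<close> are both tiny compared with \<open>k\<close>.

  A geodesic issuing from a vertex \<open>u\<close> chooses its \<open>r\<close>-th step among \<open>b (r - 1)\<close> vertices, whereas its
  distance to a fixed vertex \<open>w\<close> can jump from \<open>j\<close> to \<open>j + 1\<close> along at most \<open>b j\<close> edges only. Two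
  geodesics from \<open>u\<close> whose ends \<open>v, v'\<close> are at distance \<open>j + 1\<close> therefore keep most \<open>w\<close> of the sphere
  of radius \<open>j\<close> around \<open>u\<close> within distance \<open>j\<close> of both ends, unless \<open>b j\<close> is comparable to
  \<open>b (j div 2)\<close>. For \<open>j < t\<close> the spheres grow fast, and the balls of radius \<open>j\<close> around \<open>v\<close> and \<open>v'\<close>
  have a small intersection; hence \<open>b j \<ge> b (j div 2) / (j + 1)\<close> up to a factor close to 1, and
  iterating gives \<open>b (t - 1) \<ge> k d^(- log d) / 2\<close> up to such a factor. Likewise, the spheres of radius
  \<open>t\<close> around adjacent vertices almost coincide, which forces \<open>c (t + 1) \<ge> b (t - 1) / t\<close>, again up
  to a factor close to 1.

  The eigenvalues other than the simple eigenvalue \<open>k\<close> are eigenvalues of the tridiagonal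
  \<open>d\<close> by \<open>d\<close> matrix with diagonal entries \<open>k - b i - c (i + 1)\<close> and rows
  \<open>c i, k - b i - c (i + 1), b (i + 1)\<close>. Up to tiny entries it is upper triangular before row \<open>t\<close> and
  lower triangular from row \<open>t\<close> on, so after a diagonal rescaling all its Gershgorin discs lie
  close to its diagonal entries, which are bounded away from \<open>k\<close>.\<close>

section \<open>Counting identities and a weighted Gershgorin bound\<close>

lemma double_counting:
  assumes "finite X" "finite Y"
  shows "(\<Sum>x\<in>X. card {y\<in>Y. R x y}) = (\<Sum>y\<in>Y. card {x\<in>X. R x y})"
proof -
  have "(\<Sum>x\<in>X. card {y\<in>Y. R x y}) = (\<Sum>x\<in>X. \<Sum>y\<in>Y. if R x y then 1 else 0)"
    using assms by (simp add: sum.If_cases Int_def)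
  also have "\<dots> = (\<Sum>y\<in>Y. \<Sum>x\<in>X. if R x y then 1 else 0)"
    by (rule sum.swap)
  also have "\<dots> = (\<Sum>y\<in>Y. card {x\<in>X. R x y})"
    using assms by (simp add: sum.If_cases Int_def)
  finally show ?thesis .
qed

lemma sum_by_value:
  fixes f :: "nat \<Rightarrow> nat"
  assumes "finite X" "\<And>x. x \<in> X \<Longrightarrow> g x \<le> d"
  shows "(\<Sum>x\<in>X. f (g x)) = (\<Sum>m\<le>d. card {x\<in>X. g x = m} * f m)"
proof -
  have "(\<Sum>m\<le>d. card {x\<in>X. g x = m} * f m) = (\<Sum>m\<le>d. \<Sum>x\<in>{x\<in>X. g x = m}. f (g x))"
    by simp
  also have "\<dots> = (\<Sum>x\<in>X. f (g x))"
    using assms by (intro sum.group) auto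
  finally show ?thesis by simp
qed

text \<open>Gershgorin's argument in a weighted maximum norm: take the row where
  \<open>\<bar>D i\<bar> / \<omega> i\<close> is largest. \<open>r_last\<close> removes the value
  \<open>D d\<close> outside the matrix. In row 0 the truncated index \<open>0 - 1\<close> lets
  \<open>l 0\<close> act on \<open>D 0\<close>, and \<open>row\<close> counts it
  accordingly.\<close>

lemma weighted_gershgorin_tridiagonal:
  fixes D l m r \<omega> :: "nat \<Rightarrow> real" and \<theta> \<rho> :: real
  assumes eq: "\<And>i. i < d \<Longrightarrow> \<theta> * D i = l i * D (i - 1) + m i * D i + r i * D (Suc i)"
    and r_last: "r (d - 1) = 0"
    and nz: "\<exists>i<d. D i \<noteq> 0"
    and pos: "\<And>i. i < d \<Longrightarrow> \<omega> i > 0"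
    and row: "\<And>i. i < d \<Longrightarrow> \<bar>l i\<bar> * \<omega> (i - 1) + \<bar>r i\<bar> * \<omega> (Suc i) \<le> \<rho> * \<omega> i"
  shows "\<exists>i<d. \<bar>\<theta> - m i\<bar> \<le> \<rho>"
proof -
  let ?f = "\<lambda>i. \<bar>D i\<bar> / \<omega> i"
  define M where "M = Max (?f ` {..<d})"
  have ne: "?f ` {..<d} \<noteq> {}" using nz by auto
  have le_M: "\<bar>D i\<bar> \<le> M * \<omega> i" if "i < d" for i
  proof -
    have "?f i \<le> M" unfolding M_def using that by (intro Max_ge) auto
    then show ?thesis using pos[OF that] by (simp add: field_simps)
  qed
  have "M \<in> ?f ` {..<d}" unfolding M_def using ne by (intro Max_in) auto
  then obtain i where i: "i < d" "M = ?f i" by auto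
  obtain j where j: "j < d" "D j \<noteq> 0" using nz by auto
  have "0 < \<bar>D j\<bar>" using j by simp
  also have "\<dots> \<le> M * \<omega> j" using le_M j by simp
  finally have M: "M > 0" using pos[OF j(1)] by (simp add: zero_less_mult_iff)
  have Di: "\<bar>D i\<bar> = M * \<omega> i" using i pos[OF i(1)] by simp
  have "(\<theta> - m i) * D i = l i * D (i - 1) + r i * D (Suc i)"
    using eq[OF i(1)] by (simp add: algebra_simps)
  then have "\<bar>\<theta> - m i\<bar> * \<bar>D i\<bar> = \<bar>l i * D (i - 1) + r i * D (Suc i)\<bar>"
    by (metis abs_mult)
  also have "\<dots> \<le> \<bar>l i\<bar> * \<bar>D (i - 1)\<bar> + \<bar>r i\<bar> * \<bar>D (Suc i)\<bar>"
    by (metis abs_mult abs_triangle_ineq)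
  also have "\<dots> \<le> \<bar>l i\<bar> * (M * \<omega> (i - 1)) + \<bar>r i\<bar> * (M * \<omega> (Suc i))"
  proof (intro add_mono)
    show "\<bar>l i\<bar> * \<bar>D (i - 1)\<bar> \<le> \<bar>l i\<bar> * (M * \<omega> (i - 1))"
      using i le_M by (intro mult_left_mono) auto
    show "\<bar>r i\<bar> * \<bar>D (Suc i)\<bar> \<le> \<bar>r i\<bar> * (M * \<omega> (Suc i))"
    proof (cases "Suc i < d")
      case True then show ?thesis using le_M by (intro mult_left_mono) auto
    next
      case False
      then have "i = d - 1" using i by simp
      then show ?thesis using r_last by simp
    qed
  qed
  also have "\<dots> = M * (\<bar>l i\<bar> * \<omega> (i - 1) + \<bar>r i\<bar> * \<omega> (Suc i))" by (simp add: algebra_simps)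
  also have "\<dots> \<le> M * (\<rho> * \<omega> i)" using row[OF i(1)] M by (intro mult_left_mono) auto
  also have "\<dots> = \<rho> * \<bar>D i\<bar>" by (simp add: Di)
  finally have "\<bar>\<theta> - m i\<bar> \<le> \<rho>" using Di M pos[OF i(1)] by simp
  then show ?thesis using i by blast
qed

section \<open>Characteristic polynomials\<close>

text \<open>Constant row sums make the all-ones vector an eigenvector. In the basis of that vector
  and the last \<open>m\<close> unit vectors, the columns of \<open>P\<close>, the matrix becomes
  block triangular. Thus exactly one factor for \<open>k\<close> splits off, whatever the
  multiplicity of \<open>k\<close>.\<close>

lemma char_poly_deflate:
  fixes F :: "nat \<Rightarrow> nat \<Rightarrow> 'a :: field"
  assumes rows: "\<And>i. i < Suc m \<Longrightarrow> (\<Sum>j<Suc m. F i j) = k"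
  shows "char_poly (mat (Suc m) (Suc m) (\<lambda>(i, j). F i j)) =
    [:- k, 1:] * char_poly (mat m m (\<lambda>(i, j). F (Suc i) (Suc j) - F 0 (Suc j)))"
proof -
  let ?n = "Suc m"
  define A where "A = mat ?n ?n (\<lambda>(i, j). F i j)"
  define B where "B = mat m m (\<lambda>(i, j). F (Suc i) (Suc j) - F 0 (Suc j))"
  define P :: "'a mat" where
    "P = mat ?n ?n (\<lambda>(i, j). (if j = 0 then 1 else 0) + (if j = i then (if i = 0 then 0 else 1) else 0))"
  define Q :: "'a mat" where
    "Q = mat ?n ?n (\<lambda>(i, j). (if i = j then 1 else 0) - (if j = 0 then (if i = 0 then 0 else 1) else 0))"
  define A' where "A' = mat ?n ?n (\<lambda>(i, j). if j = 0 then (if i = 0 then k else 0)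
     else if i = 0 then F 0 j else F i j - F 0 j)"
  have carr [simp]: "A \<in> carrier_mat ?n ?n" "P \<in> carrier_mat ?n ?n" "Q \<in> carrier_mat ?n ?n"
      "A' \<in> carrier_mat ?n ?n" "B \<in> carrier_mat m m"
    by (simp_all add: A_def P_def Q_def A'_def B_def)
  have Pmult: "(P * X) $$ (i, j) = X $$ (0, j) + (if i = 0 then 0 else X $$ (i, j))"
    if "X \<in> carrier_mat ?n ?n" "i < ?n" "j < ?n" for X i j
  proof -
    have "(P * X) $$ (i, j) = (\<Sum>l\<in>{0..<?n}. P $$ (i, l) * X $$ (l, j))"
      using that(2,3) carrier_matD[OF that(1)] carrier_matD[OF carr(2)]
      by (simp add: scalar_prod_def del: sum.op_ivl_Suc)
    also have "\<dots> = (\<Sum>l\<in>{0..<?n}. (if l = 0 then X $$ (l, j) else 0) + (if l = i then (if i = 0 then 0 else X $$ (l, j)) else 0))"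
      using that by (intro sum.cong) (auto simp: P_def)
    also have "\<dots> = X $$ (0, j) + (if i = 0 then 0 else X $$ (i, j))"
      using that by (simp add: sum.distrib del: sum.op_ivl_Suc)
    finally show ?thesis .
  qed
  have PQ: "P * Q = 1\<^sub>m ?n"
  proof (rule eq_matI)
    fix i j assume "i < dim_row (1\<^sub>m ?n :: 'a mat)" "j < dim_col (1\<^sub>m ?n :: 'a mat)"
    then show "(P * Q) $$ (i, j) = 1\<^sub>m ?n $$ (i, j)"
      using Pmult[OF carr(3), of i j] by (auto simp: Q_def)
  qed (simp_all add: P_def Q_def)
  have QP: "Q * P = 1\<^sub>m ?n"
    using mat_mult_left_right_inverse[OF carr(2,3) PQ] .
  have AP: "A * P = P * A'"
  proof (rule eq_matI)
    fix i j assume "i < dim_row (P * A')" "j < dim_col (P * A')"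
    then have ij: "i < ?n" "j < ?n" by (auto simp: P_def A'_def)
    have "(A * P) $$ (i, j) = (\<Sum>l\<in>{0..<?n}. A $$ (i, l) * P $$ (l, j))"
      using ij carrier_matD[OF carr(1)] carrier_matD[OF carr(2)]
      by (simp add: scalar_prod_def del: sum.op_ivl_Suc)
    also have "\<dots> = (\<Sum>l\<in>{0..<?n}. (if j = 0 then F i l else 0) + (if l = j then (if j = 0 then 0 else F i l) else 0))"
      using ij by (intro sum.cong) (auto simp: P_def A_def)
    also have "\<dots> = (if j = 0 then k else F i j)"
      using ij rows[OF ij(1)] by (auto simp: sum.distrib atLeast0LessThan simp del: sum.op_ivl_Suc sum.lessThan_Suc)
    also have "\<dots> = (P * A') $$ (i, j)"
      using Pmult[OF carr(4) ij] ij by (auto simp: A'_def)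
    finally show "(A * P) $$ (i, j) = (P * A') $$ (i, j)" .
  qed (auto simp: A_def P_def A'_def)
  have "A = A * (P * Q)" by (simp add: PQ right_mult_one_mat[OF carr(1)])
  also have "\<dots> = P * A' * Q" using AP carr by (metis assoc_mult_mat)
  finally have "similar_mat_wit A A' P Q"
    by (rule similar_mat_witI[OF PQ QP _ carr(1,4,2,3)])
  then have "char_poly A = char_poly A'"
    by (intro char_poly_similar) (auto simp: similar_mat_def)
  also have "A' = four_block_mat (mat 1 1 (\<lambda>_. k)) (mat 1 m (\<lambda>(i, j). F 0 (Suc j))) (0\<^sub>m m 1) B"
    by (rule eq_matI) (auto simp: A'_def B_def)
  also have "char_poly \<dots> = char_poly (mat 1 1 (\<lambda>_. k)) * char_poly B"
    by (rule char_poly_four_block_zeros_col) (auto simp: B_def)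
  also have "char_poly (mat 1 1 (\<lambda>_. k)) = [:- k, 1:]"
    by (subst char_poly_upper_triangular[where n = 1]) (auto simp: diag_mat_def)
  finally show ?thesis by (simp add: A_def B_def)
qed

text \<open>An eigenvector of the deflated matrix, extended by 0 at index 0, satisfies the
  eigenvalue equation of \<open>F\<close> up to the constant \<open>s\<close>, which is the row 0
  that deflation subtracted. Being nonzero, it is not constant after the extension.\<close>

lemma deflated_eigenvector:
  fixes F :: "nat \<Rightarrow> nat \<Rightarrow> 'a :: field"
  assumes "poly (char_poly (mat m m (\<lambda>(i, j). F (Suc i) (Suc j) - F 0 (Suc j)))) \<theta> = 0"
  obtains x s where "\<exists>v<Suc m. x v \<noteq> x 0" "\<And>v. v < Suc m \<Longrightarrow> (\<Sum>w<Suc m. F v w * x w) = \<theta> * x v + s"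
proof -
  let ?B = "mat m m (\<lambda>(i, j). F (Suc i) (Suc j) - F 0 (Suc j))"
  have "eigenvalue ?B \<theta>" using assms eigenvalue_root_char_poly[of ?B m] by simp
  then obtain y where y: "y \<in> carrier_vec m" "y \<noteq> 0\<^sub>v m" "?B *\<^sub>v y = \<theta> \<cdot>\<^sub>v y"
    by (auto simp: eigenvalue_def eigenvector_def)
  define x where "x i = (case i of 0 \<Rightarrow> 0 | Suc j \<Rightarrow> y $ j)" for i
  define s where "s = (\<Sum>w<Suc m. F 0 w * x w)"
  have sum_x: "(\<Sum>w<Suc m. F v w * x w) = (\<Sum>j<m. F v (Suc j) * y $ j)" for v
    by (subst sum.lessThan_Suc_shift) (simp add: x_def)
  show thesis
  proof (rule that)
    obtain j where "j < m" "y $ j \<noteq> 0"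
      using y(1,2) by (metis carrier_vecD eq_vecI index_zero_vec)
    then show "\<exists>v<Suc m. x v \<noteq> x 0" by (intro exI[of _ "Suc j"]) (simp add: x_def)
    fix v assume v: "v < Suc m"
    show "(\<Sum>w<Suc m. F v w * x w) = \<theta> * x v + s"
    proof (cases v)
      case 0 then show ?thesis by (simp add: s_def x_def)
    next
      case (Suc i)
      then have i: "i < m" using v by simp
      have "\<theta> * y $ i = (?B *\<^sub>v y) $ i" using y i by simp
      also have "\<dots> = (\<Sum>j<m. (F (Suc i) (Suc j) - F 0 (Suc j)) * y $ j)"
        using i y(1) by (simp add: scalar_prod_def atLeast0LessThan)
      also have "\<dots> = (\<Sum>w<Suc m. F v w * x w) - s"
        unfolding s_def sum_x Suc by (simp add: left_diff_distrib sum_subtractf)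
      finally show ?thesis using Suc by (simp add: x_def)
    qed
  qed
qed

lemma symmetric_eigenvalue_real:
  fixes F :: "nat \<Rightarrow> nat \<Rightarrow> real"
  assumes sym: "\<And>i j. i < n \<Longrightarrow> j < n \<Longrightarrow> F i j = F j i"
    and ev: "eigenvalue (mat n n (\<lambda>(i, j). complex_of_real (F i j))) z"
  shows "Im z = 0"
proof -
  let ?A = "mat n n (\<lambda>(i, j). complex_of_real (F i j))"
  obtain y where y: "y \<in> carrier_vec n" "y \<noteq> 0\<^sub>v n" "?A *\<^sub>v y = z \<cdot>\<^sub>v y"
    using ev by (auto simp: eigenvalue_def eigenvector_def)
  define R where "R = (\<Sum>i<n. (cmod (y $ i))\<^sup>2)"
  \<comment> \<open>The Hermitian form of the matrix at \<open>y\<close>: it equals \<open>z\<close>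
    times the squared norm, and by symmetry it is its own conjugate.\<close>
  define S where "S = (\<Sum>i<n. \<Sum>j<n. cnj (y $ i) * (of_real (F i j) * y $ j))"
  have row: "(\<Sum>j<n. of_real (F i j) * y $ j) = z * y $ i" if "i < n" for i
  proof -
    have "z * y $ i = (?A *\<^sub>v y) $ i" using y that by simp
    then show ?thesis using that y(1) by (simp add: scalar_prod_def atLeast0LessThan)
  qed
  have S1: "S = z * of_real R"
  proof -
    have "S = (\<Sum>i<n. cnj (y $ i) * (z * y $ i))"
      unfolding S_def by (intro sum.cong refl) (simp add: sum_distrib_left[symmetric] row)
    also have "\<dots> = (\<Sum>i<n. z * of_real ((cmod (y $ i))\<^sup>2))"
      unfolding complex_norm_square by (intro sum.cong refl) (simp only: mult_ac)
    finally show ?thesis by (simp add: R_def sum_distrib_left)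
  qed
  have "cnj S = (\<Sum>i<n. \<Sum>j<n. y $ i * (of_real (F i j) * cnj (y $ j)))"
    by (simp add: S_def)
  also have "\<dots> = (\<Sum>j<n. \<Sum>i<n. y $ i * (of_real (F i j) * cnj (y $ j)))"
    by (rule sum.swap)
  also have "\<dots> = S"
    unfolding S_def by (intro sum.cong refl) (simp add: sym mult_ac)
  finally have "cnj z * of_real R = z * of_real R" by (simp add: S1)
  moreover have "R \<noteq> 0"
  proof
    assume "R = 0"
    then have "\<forall>i<n. y $ i = 0"
      unfolding R_def by (subst (asm) sum_nonneg_eq_0_iff) auto
    then show False using y(1,2) by (metis carrier_vecD eq_vecI index_zero_vec)
  qed
  ultimately have "cnj z = z" by simp
  then show ?thesis by (simp add: complex_eq_iff)
qed

text \<open>This will show that eigenvalues remain after one \<open>k\<close> is split off: a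
  complex root of the factor is an eigenvalue of a real symmetric matrix, hence real.\<close>

lemma symmetric_char_poly_factor_has_root:
  fixes F :: "nat \<Rightarrow> nat \<Rightarrow> real"
  assumes sym: "\<And>i j. i < n \<Longrightarrow> j < n \<Longrightarrow> F i j = F j i"
    and dvd: "q dvd char_poly (mat n n (\<lambda>(i, j). F i j))" and deg: "degree q > 0"
  obtains \<theta> where "poly q \<theta> = 0"
proof -
  interpret hom: map_poly_comm_ring_hom "of_real :: real \<Rightarrow> complex" ..
  let ?A = "mat n n (\<lambda>(i, j). F i j)"
  let ?C = "mat n n (\<lambda>(i, j). complex_of_real (F i j))"
  have C: "?C = map_mat of_real ?A" by (rule eq_matI) auto
  obtain z where z: "poly (map_poly complex_of_real q) z = 0"
    using alg_closed_imp_poly_has_root[of "map_poly complex_of_real q"] deg by auto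
  obtain r where "char_poly ?A = q * r" using dvd by (elim dvdE)
  moreover have "char_poly ?C = map_poly of_real (char_poly ?A)"
    unfolding C by (rule of_real_hom.char_poly_hom[of _ n]) simp
  ultimately have "poly (char_poly ?C) z = 0"
    using z by (simp add: hom.hom_mult)
  then have "eigenvalue ?C z" using eigenvalue_root_char_poly[of ?C n] by simp
  then have "Im z = 0" using symmetric_eigenvalue_real[of n F z] sym by blast
  then have "z = of_real (Re z)" by (simp add: complex_eq_iff)
  then have "complex_of_real (poly q (Re z)) = 0"
    using z by (metis of_real_hom.poly_map_poly)
  then show thesis using that by simp
qed

section \<open>Distance-regular graphs\<close>

locale distance_regular_graph =
  fixes n :: nat and E :: "nat \<Rightarrow> nat \<Rightarrow> bool" and d :: nat and a b c :: "nat \<Rightarrow> nat"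
  assumes drg: "distance_regular n E d a b c"
begin

abbreviation dst :: "nat \<Rightarrow> nat \<Rightarrow> nat" where "dst \<equiv> gdist E"

definition sphere :: "nat \<Rightarrow> nat \<Rightarrow> nat set" where
  "sphere u i = {w. w < n \<and> dst u w = i}"

definition ball :: "nat \<Rightarrow> nat \<Rightarrow> nat set" where
  "ball u i = {w. w < n \<and> dst u w \<le> i}"

text \<open>Measured from vertex 0; \<open>card_sphere\<close> shows later that every centre gives
  the same number.\<close>

definition ksize :: "nat \<Rightarrow> nat" where
  "ksize i = card (sphere 0 i)"

lemma finite_sphere [simp]: "finite (sphere u i)"
  by (simp add: sphere_def)

lemma finite_ball [simp]: "finite (ball u i)"
  by (simp add: ball_def)

section \<open>The path metric and geodesics\<close>

lemma edge_less: "E u v \<Longrightarrow> u < n \<and> v < n"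
  using drg by (auto simp: distance_regular_def simple_graph_def)

lemma edge_sym: "E u v \<Longrightarrow> E v u"
  using drg by (auto simp: distance_regular_def simple_graph_def)

lemma edge_commute: "E u v \<longleftrightarrow> E v u"
  using edge_sym by blast

lemma n_pos: "0 < n"
  using drg by (auto simp: distance_regular_def connected_graph_def)

lemma walk_exists: "u < n \<Longrightarrow> v < n \<Longrightarrow> \<exists>m. (E ^^ m) u v"
  using drg by (auto simp: distance_regular_def connected_graph_def)

lemma walk_dst: "u < n \<Longrightarrow> v < n \<Longrightarrow> (E ^^ dst u v) u v"
  unfolding gdist_def using walk_exists by (metis LeastI_ex)

lemma dst_le_walk: "(E ^^ m) u v \<Longrightarrow> dst u v \<le> m"
  unfolding gdist_def by (rule Least_le)

lemma walk_sym: "(E ^^ m) u v \<Longrightarrow> (E ^^ m) v u"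
proof (induction m arbitrary: v)
  case (Suc m)
  then obtain w where "(E ^^ m) u w" "E w v" by (auto elim: relpowp_Suc_E)
  then show ?case using Suc.IH edge_sym by (metis relpowp_Suc_I2)
qed auto

lemma dst_sym: "dst u v = dst v u"
  unfolding gdist_def using walk_sym by metis

lemma dst_le_diameter: "u < n \<Longrightarrow> v < n \<Longrightarrow> dst u v \<le> d"
  using drg by (auto simp: distance_regular_def has_diameter_def)

lemma dst_self [simp]: "dst u u = 0"
  using dst_le_walk[of 0 u u] by simp

lemma dst_eq_0_iff: "u < n \<Longrightarrow> v < n \<Longrightarrow> dst u v = 0 \<longleftrightarrow> u = v"
  using walk_dst[of u v] by auto

lemma dst_triangle: "u < n \<Longrightarrow> v < n \<Longrightarrow> w < n \<Longrightarrow> dst u w \<le> dst u v + dst v w"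
  using dst_le_walk[OF relpowp_trans[OF walk_dst walk_dst]] by blast

lemma dst_edge_le: "E u v \<Longrightarrow> dst u v \<le> 1"
  using dst_le_walk[of 1 u v] by (simp only: relpowp_1)

lemma dst_step:
  assumes "u < n" "E v w"
  shows "dst u w \<le> dst u v + 1" "dst u v \<le> dst u w + 1" "dst w u \<le> dst v u + 1" "dst v u \<le> dst w u + 1"
proof -
  have vw: "v < n" "w < n" "E w v" using edge_less edge_sym assms by auto
  show 1: "dst u w \<le> dst u v + 1"
    using dst_triangle[of u v w] dst_edge_le[OF assms(2)] assms vw by linarith
  show 2: "dst u v \<le> dst u w + 1"
    using dst_triangle[of u w v] dst_edge_le[OF vw(3)] assms vw by linarith
  show "dst w u \<le> dst v u + 1" "dst v u \<le> dst w u + 1"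
    using 1 2 by (simp_all add: dst_sym[of _ u])
qed

lemma intermediate_vertex:
  assumes "u < n" "v < n" "dst u v = i + j"
  obtains x where "x < n" "dst u x = i" "dst x v = j"
proof -
  have "(E ^^ (i + j)) u v" using walk_dst[of u v] assms by simp
  then obtain x where x: "(E ^^ i) u x" "(E ^^ j) x v"
    by (auto simp: relpowp_add)
  have xn: "x < n"
  proof (cases i)
    case 0 then show ?thesis using x assms by auto
  next
    case (Suc m) then show ?thesis using x edge_less by (metis relpowp_Suc_E)
  qed
  have "dst u x \<le> i" "dst x v \<le> j" "i + j \<le> dst u x + dst x v"
    using x dst_le_walk dst_triangle[OF assms(1) xn assms(2)] assms(3) by auto
  then show thesis using that xn by fastforce
qed

lemma edge_of_dst_1:
  assumes "u < n" "v < n" "dst u v = 1"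
  shows "E u v"
  using walk_dst[OF assms(1,2)] assms(3) by (simp only: relpowp_1)

lemma dst_edge: "E u v \<Longrightarrow> dst u v = 1"
proof -
  assume e: "E u v"
  then have "u \<noteq> v" using drg by (auto simp: distance_regular_def simple_graph_def)
  then have "dst u v \<noteq> 0" using dst_eq_0_iff edge_less[OF e] by auto
  then show ?thesis using dst_edge_le[OF e] by linarith
qed

section \<open>Intersection parameters and their monotonicity\<close>

lemma pair_at_distance:
  assumes "i \<le> d"
  obtains u v where "u < n" "v < n" "dst u v = i"
proof -
  obtain u v where uv: "u < n" "v < n" "dst u v = d"
    using drg by (auto simp: distance_regular_def has_diameter_def)
  obtain x where "x < n" "dst u x = i" "dst x v = d - i"
    by (rule intermediate_vertex[OF uv(1,2), of i "d - i"]) (use uv assms in auto)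
  then show thesis using that uv by blast
qed

lemma card_b:
  assumes "v < n" "w < n" "dst v w = i"
  shows "card {u. u < n \<and> E w u \<and> dst v u = Suc i} = b i"
  using drg assms dst_le_diameter[OF assms(1,2)] unfolding distance_regular_def by auto

lemma card_a:
  assumes "v < n" "w < n" "dst v w = i"
  shows "card {u. u < n \<and> E w u \<and> dst v u = i} = a i"
  using drg assms dst_le_diameter[OF assms(1,2)] unfolding distance_regular_def by auto

lemma card_c:
  assumes "v < n" "w < n" "dst v w = Suc i"
  shows "card {u. u < n \<and> E w u \<and> dst v u = i} = c (Suc i)"
proof -
  have "\<forall>i\<le>d. \<forall>v<n. \<forall>w<n. dst v w = i \<longrightarrow>
        (i \<ge> 1 \<longrightarrow> card {u. u < n \<and> E w u \<and> dst v u + 1 = i} = c i)"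
    using drg unfolding distance_regular_def by blast
  from this[rule_format, of "Suc i" v w] show ?thesis
    using assms dst_le_diameter[OF assms(1,2)] by simp
qed

text \<open>The tridiagonal intersection matrix. Its entry \<open>c m\<close> occurs only for
  \<open>m \<ge> 1\<close>, so the unconstrained value \<open>c 0\<close> never enters.\<close>

definition inum :: "nat \<Rightarrow> nat \<Rightarrow> nat" where
  "inum m l = (if l = Suc m then b m else if l = m then a m else if m = Suc l then c m else 0)"

lemma card_neighbours_at:
  assumes "v < n" "w < n"
  shows "card {u. u < n \<and> E w u \<and> dst v u = l} = inum (dst v w) l"
proof (cases "l \<le> dst v w + 1 \<and> dst v w \<le> l + 1")
  case True
  then consider "l = Suc (dst v w)" | "l = dst v w" | "dst v w = Suc l" by linarith
  then show ?thesis
    by cases (simp_all add: inum_def card_a[OF assms] card_b[OF assms] card_c[OF assms])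
next
  case False
  then have "{u. u < n \<and> E w u \<and> dst v u = l} = {}"
    using dst_step[OF assms(1)] by fastforce
  then have "card {u. u < n \<and> E w u \<and> dst v u = l} = 0" by (simp only: card.empty)
  then show ?thesis using False by (auto simp: inum_def)
qed

lemma b_diameter: "b d = 0"
proof -
  obtain u v where uv: "u < n" "v < n" "dst u v = d" using pair_at_distance[of d] by blast
  have "{x. x < n \<and> E v x \<and> dst u x = Suc d} = {}"
    using dst_le_diameter[OF uv(1)] by fastforce
  then show ?thesis using card_b[OF uv] by (simp only: card.empty)
qed

lemma degree:
  assumes "v < n"
  shows "card {u. u < n \<and> E v u} = b 0"
proof -
  have "{u. u < n \<and> E v u} = {u. u < n \<and> E v u \<and> dst v u = Suc 0}"
    using dst_edge by auto
  then show ?thesis using card_b[OF assms assms, of 0] by simp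
qed

lemma degree_split:
  assumes "1 \<le> i" "i \<le> d"
  shows "a i + b i + c i = b 0"
proof -
  obtain u v where uv: "u < n" "v < n" "dst u v = i" using pair_at_distance[of i] assms by blast
  obtain j where j: "i = Suc j" using assms by (cases i) auto
  have eq: "{x. x < n \<and> E v x} = {x. x < n \<and> E v x \<and> dst u x = Suc i} \<union>
      ({x. x < n \<and> E v x \<and> dst u x = i} \<union> {x. x < n \<and> E v x \<and> dst u x = j})"
  proof (rule Set.set_eqI)
    fix x
    have "E v x \<Longrightarrow> dst u x = Suc i \<or> dst u x = i \<or> dst u x = j"
      using dst_step(1,2)[OF uv(1), of v x] uv j by linarith
    then show "x \<in> {x. x < n \<and> E v x} \<longleftrightarrow> x \<in> {x. x < n \<and> E v x \<and> dst u x = Suc i} \<union>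
      ({x. x < n \<and> E v x \<and> dst u x = i} \<union> {x. x < n \<and> E v x \<and> dst u x = j})" by blast
  qed
  have "card {x. x < n \<and> E v x} = card {x. x < n \<and> E v x \<and> dst u x = Suc i} +
      card ({x. x < n \<and> E v x \<and> dst u x = i} \<union> {x. x < n \<and> E v x \<and> dst u x = j})"
    by (subst eq, intro card_Un_disjoint) (auto simp: j)
  also have "card ({x. x < n \<and> E v x \<and> dst u x = i} \<union> {x. x < n \<and> E v x \<and> dst u x = j}) =
      card {x. x < n \<and> E v x \<and> dst u x = i} + card {x. x < n \<and> E v x \<and> dst u x = j}"
    by (intro card_Un_disjoint) (auto simp: j)
  finally show ?thesis
    using card_b[OF uv] card_a[OF uv] card_c[of u v j] uv j degree[OF uv(2)] by simp
qed

lemma degree_split_0: "a 0 + b 0 = b 0"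
proof -
  have "{u. u < n \<and> E 0 u \<and> dst 0 u = 0} = {}"
    using dst_edge by fastforce
  then have "a 0 = 0" using card_a[of 0 0 0] n_pos by (simp only: card.empty dst_self)
  then show ?thesis by simp
qed

lemma c_pos:
  assumes "Suc i \<le> d"
  shows "0 < c (Suc i)"
proof -
  obtain u v where uv: "u < n" "v < n" "dst u v = Suc i" using pair_at_distance assms by blast
  obtain x where "x < n" "dst u x = i" "dst x v = 1"
    by (rule intermediate_vertex[OF uv(1,2), of i 1]) (use uv in auto)
  then have "x \<in> {x. x < n \<and> E v x \<and> dst u x = i}"
    using edge_of_dst_1 edge_sym uv by auto
  then have "card {x. x < n \<and> E v x \<and> dst u x = i} \<noteq> 0" by auto
  then show ?thesis using card_c[OF uv] by simp
qed

lemma b_pos: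
  assumes "i < d"
  shows "0 < b i"
proof -
  obtain u v where uv: "u < n" "v < n" "dst u v = Suc i" using pair_at_distance[of "Suc i"] assms by auto
  obtain x where x: "x < n" "dst u x = i" "dst x v = 1"
    by (rule intermediate_vertex[OF uv(1,2), of i 1]) (use uv in auto)
  then have "v \<in> {y. y < n \<and> E x y \<and> dst u y = Suc i}"
    using edge_of_dst_1 uv by auto
  then have "card {y. y < n \<and> E x y \<and> dst u y = Suc i} \<noteq> 0" by auto
  then show ?thesis using card_b[OF uv(1) x(1,2)] by simp
qed

text \<open>Replace \<open>u\<close> by its neighbour \<open>x\<close> on a geodesic to
  \<open>w\<close>: a neighbour of \<open>w\<close> that is farther from \<open>u\<close> than
  \<open>w\<close> is also farther from \<open>x\<close>.\<close>

lemma b_Suc_le: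
  assumes "Suc i \<le> d"
  shows "b (Suc i) \<le> b i"
proof -
  obtain u w where uw: "u < n" "w < n" "dst u w = Suc i" using pair_at_distance assms by blast
  obtain x where x: "x < n" "dst u x = 1" "dst x w = i"
    by (rule intermediate_vertex[OF uw(1,2), of 1 i]) (use uw in auto)
  have ux: "E u x" using edge_of_dst_1[OF uw(1) x(1,2)] .
  have "{y. y < n \<and> E w y \<and> dst u y = Suc (Suc i)} \<subseteq> {y. y < n \<and> E w y \<and> dst x y = Suc i}"
  proof safe
    fix y assume y: "y < n" "E w y" "dst u y = Suc (Suc i)"
    have "dst x y \<le> Suc i" using dst_step(1)[OF x(1) y(2)] x by simp
    moreover have "Suc (Suc i) \<le> dst x y + 1" using dst_step(4)[OF y(1) ux] y by simp
    ultimately show "dst x y = Suc i" by simp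
  qed
  then have "card {y. y < n \<and> E w y \<and> dst u y = Suc (Suc i)} \<le> card {y. y < n \<and> E w y \<and> dst x y = Suc i}"
    by (intro card_mono) auto
  then show ?thesis using card_b[OF uw] card_b[OF x(1) uw(2) x(3)] by simp
qed

text \<open>The same move of \<open>u\<close> to \<open>x\<close>: a neighbour of \<open>w\<close>
  that is closer to \<open>x\<close> is also closer to \<open>u\<close>.\<close>

lemma c_Suc_le:
  assumes "Suc (Suc i) \<le> d"
  shows "c (Suc i) \<le> c (Suc (Suc i))"
proof -
  obtain u w where uw: "u < n" "w < n" "dst u w = Suc (Suc i)" using pair_at_distance assms by blast
  obtain x where x: "x < n" "dst u x = 1" "dst x w = Suc i"
    by (rule intermediate_vertex[OF uw(1,2), of 1 "Suc i"]) (use uw in auto)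
  have ux: "E u x" using edge_of_dst_1[OF uw(1) x(1,2)] .
  have "{y. y < n \<and> E w y \<and> dst x y = i} \<subseteq> {y. y < n \<and> E w y \<and> dst u y = Suc i}"
  proof (rule subsetI, simp only: mem_Collect_eq, elim conjE, intro conjI)
    fix y assume y: "y < n" "E w y" "dst x y = i"
    have "Suc (Suc i) \<le> dst u y + 1" using dst_step(2)[OF uw(1) y(2)] uw by simp
    moreover have "dst u y \<le> i + 1" using dst_step(4)[OF y(1) ux] y by simp
    ultimately show "dst u y = Suc i" by simp
  qed auto
  then have "card {y. y < n \<and> E w y \<and> dst x y = i} \<le> card {y. y < n \<and> E w y \<and> dst u y = Suc i}"
    by (intro card_mono) auto
  then show ?thesis using card_c[OF uw] card_c[OF x(1) uw(2) x(3)] by simp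
qed

lemma b_antimono:
  assumes "i \<le> j" "j \<le> d"
  shows "b j \<le> b i"
  using assms by (induction j rule: dec_induct) (auto intro: order_trans[OF b_Suc_le])

lemma c_mono:
  assumes "1 \<le> i" "i \<le> j" "j \<le> d"
  shows "c i \<le> c j"
  using assms(2,3)
proof (induction j rule: dec_induct)
  case (step m)
  then have "c m \<le> c (Suc m)" using assms(1) c_Suc_le[of "m - 1"] by (cases m) auto
  with step show ?case by simp
qed auto

subsection \<open>Intersection numbers\<close>

text \<open>Both sides count the edges from \<open>sphere u i\<close> to \<open>sphere v l\<close>,
  sorted by the distance of one end to the other centre.\<close>

lemma intersection_recurrence:
  assumes "u < n" "v < n"
  shows "(\<Sum>m\<le>d. card (sphere u i \<inter> sphere v m) * inum m l)
       = (\<Sum>m\<le>d. card (sphere u m \<inter> sphere v l) * inum m i)"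
proof -
  have "(\<Sum>m\<le>d. card (sphere u i \<inter> sphere v m) * inum m l)
      = (\<Sum>m\<le>d. card {w \<in> sphere u i. dst v w = m} * inum m l)"
    by (intro sum.cong arg_cong2[where f = "(*)"] arg_cong[where f = card]) (auto simp: sphere_def)
  also have "\<dots> = (\<Sum>w\<in>sphere u i. inum (dst v w) l)"
    using dst_le_diameter[OF assms(2)] by (intro sum_by_value[symmetric]) (auto simp: sphere_def)
  also have "\<dots> = (\<Sum>w\<in>sphere u i. card {x\<in>sphere v l. E w x})"
  proof (intro sum.cong refl)
    fix w assume "w \<in> sphere u i"
    then have "w < n" by (simp add: sphere_def)
    from card_neighbours_at[OF assms(2) this, of l]
    show "inum (dst v w) l = card {x\<in>sphere v l. E w x}"
      by (simp add: sphere_def conj_ac)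
  qed
  also have "\<dots> = (\<Sum>x\<in>sphere v l. card {w\<in>sphere u i. E w x})"
    by (rule double_counting) auto
  also have "\<dots> = (\<Sum>x\<in>sphere v l. inum (dst u x) i)"
  proof (intro sum.cong refl)
    fix w assume "w \<in> sphere v l"
    then have "w < n" by (simp add: sphere_def)
    from card_neighbours_at[OF assms(1) this, of i]
    show "card {x\<in>sphere u i. E x w} = inum (dst u w) i"
      by (simp add: sphere_def conj_ac edge_commute[of w])
  qed
  also have "\<dots> = (\<Sum>m\<le>d. card {w \<in> sphere v l. dst u w = m} * inum m i)"
    using dst_le_diameter[OF assms(1)] by (intro sum_by_value) (auto simp: sphere_def)
  also have "\<dots> = (\<Sum>m\<le>d. card (sphere u m \<inter> sphere v l) * inum m i)"
    by (intro sum.cong arg_cong2[where f = "(*)"] arg_cong[where f = card]) (auto simp: sphere_def)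
  finally show ?thesis .
qed

lemma sphere_empty: "u < n \<Longrightarrow> d < i \<Longrightarrow> sphere u i = {}"
  using dst_le_diameter by (fastforce simp: sphere_def)

text \<open>The recurrence for radius \<open>i - 1\<close> expresses \<open>c i\<close> times the
  count for radius \<open>i\<close> through counts for smaller radii, and
  \<open>c i > 0\<close>.\<close>

lemma intersection_number_unique:
  assumes "u < n" "v < n" "u' < n" "v' < n" "dst u v = dst u' v'"
  shows "card (sphere u i \<inter> sphere v l) = card (sphere u' i \<inter> sphere v' l)"
proof (induction i arbitrary: l rule: less_induct)
  case (less i)
  show ?case
  proof (cases i)
    case 0
    have "sphere x 0 \<inter> sphere y l = (if dst x y = l then {x} else {})" if "x < n" "y < n" for x y
      using that dst_eq_0_iff[of x] dst_sym by (auto simp: sphere_def)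
    then show ?thesis using assms 0 by simp
  next
    case (Suc j)
    show ?thesis
    proof (cases "i \<le> d")
      case False
      then show ?thesis using sphere_empty assms by simp
    next
      case True
      \<comment> \<open>Column \<open>j\<close> of \<open>inum\<close> vanishes below row
        \<open>i = Suc j\<close>, and its last entry is \<open>c i\<close>.\<close>
      have split: "(\<Sum>m\<le>d. f m * inum m j) = (\<Sum>m\<le>j. f m * inum m j) + f i * c i" for f
      proof -
        have "(\<Sum>m\<le>d. f m * inum m j) = (\<Sum>m\<le>i. f m * inum m j)"
          using True Suc by (intro sum.mono_neutral_right) (auto simp: inum_def)
        then show ?thesis using Suc by (simp add: inum_def)
      qed
      have rec: "(\<Sum>m\<le>d. card (sphere x j \<inter> sphere y m) * inum m l) =
         (\<Sum>m\<le>j. card (sphere x m \<inter> sphere y l) * inum m j) + card (sphere x i \<inter> sphere y l) * c i"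
        if "x < n" "y < n" for x y
        using intersection_recurrence[OF that, of j l] split by simp
      have "(\<Sum>m\<le>d. card (sphere u j \<inter> sphere v m) * inum m l) =
            (\<Sum>m\<le>d. card (sphere u' j \<inter> sphere v' m) * inum m l)"
        using less.IH[of j] Suc by (intro sum.cong) auto
      moreover have "(\<Sum>m\<le>j. card (sphere u m \<inter> sphere v l) * inum m j) =
            (\<Sum>m\<le>j. card (sphere u' m \<inter> sphere v' l) * inum m j)"
        using less.IH Suc by (intro sum.cong) auto
      ultimately have "card (sphere u i \<inter> sphere v l) * c i = card (sphere u' i \<inter> sphere v' l) * c i"
        using rec[OF assms(1,2)] rec[OF assms(3,4)] by linarith
      then show ?thesis using c_pos[of j] True Suc by simp
    qed
  qed
qed

lemma card_sphere: "u < n \<Longrightarrow> card (sphere u i) = ksize i"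
  using intersection_number_unique[of u u 0 0 i i] n_pos by (simp add: ksize_def)

lemma card_pair_unique:
  assumes "u < n" "v < n" "u' < n" "v' < n" "dst u v = dst u' v'"
  shows "card {w. w < n \<and> Q (dst u w) (dst v w)} = card {w. w < n \<and> Q (dst u' w) (dst v' w)}"
proof -
  define I where "I = {(i, l). i \<le> d \<and> l \<le> d \<and> Q i l}"
  have fin: "finite I" by (rule finite_subset[of _ "{..d} \<times> {..d}"]) (auto simp: I_def)
  have eq: "card {w. w < n \<and> Q (dst x w) (dst y w)} = (\<Sum>p\<in>I. card (sphere x (fst p) \<inter> sphere y (snd p)))"
    if "x < n" "y < n" for x y
  proof -
    have "{w. w < n \<and> Q (dst x w) (dst y w)} = (\<Union>p\<in>I. sphere x (fst p) \<inter> sphere y (snd p))"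
      using that dst_le_diameter by (auto simp: I_def sphere_def)
    also have "card \<dots> = (\<Sum>p\<in>I. card (sphere x (fst p) \<inter> sphere y (snd p)))"
      using fin by (intro card_UN_disjoint) (auto simp: sphere_def)
    finally show ?thesis .
  qed
  show ?thesis using eq assms intersection_number_unique[OF assms] by simp
qed

lemma ksize_pos: "i \<le> d \<Longrightarrow> 0 < ksize i"
proof -
  assume "i \<le> d"
  then obtain u v where uv: "u < n" "v < n" "dst u v = i" using pair_at_distance by blast
  then have "v \<in> sphere u i" by (simp add: sphere_def)
  then have "card (sphere u i) \<noteq> 0" by auto
  then show ?thesis using card_sphere[OF uv(1)] by simp
qed

lemma ksize_0: "ksize 0 = 1"
proof -
  have "sphere 0 0 = {0}" using n_pos dst_eq_0_iff[of 0] by (auto simp: sphere_def)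
  then show ?thesis by (simp add: ksize_def)
qed

lemma edges_down:
  assumes "u < n" "y \<in> sphere u (Suc s)"
  shows "card {x \<in> sphere u s. E x y} = c (Suc s)"
  using card_c[OF assms(1), of y s] assms(2) by (simp add: sphere_def conj_ac edge_commute[of y])

lemma edges_up:
  assumes "u < n" "x \<in> sphere u s"
  shows "card {y \<in> sphere u (Suc s). E x y} = b s"
  using card_b[OF assms(1), of x s] assms(2) by (simp add: sphere_def conj_ac)

lemma ksize_Suc: "ksize (Suc i) * c (Suc i) = ksize i * b i"
proof -
  have "(\<Sum>x\<in>sphere 0 i. card {y \<in> sphere 0 (Suc i). E x y})
      = (\<Sum>y\<in>sphere 0 (Suc i). card {x \<in> sphere 0 i. E x y})"
    by (rule double_counting) auto
  then show ?thesis
    using edges_up[OF n_pos] edges_down[OF n_pos] by (simp add: ksize_def)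
qed

section \<open>Bounds on the intersection numbers\<close>

abbreviation kk :: "nat \<Rightarrow> real" where "kk i \<equiv> real (ksize i)"

definition recip_sum :: "nat \<Rightarrow> real" where
  "recip_sum s = (\<Sum>r<s. 1 / real (b r))"

text \<open>Deterministic form of a random geodesic walk from \<open>u\<close>: its \<open>r\<close>-th step chooses one of \<open>b r\<close>
  neighbours, so it enters \<open>P\<close> with probability at most \<open>\<beta> / b r\<close>.\<close>

lemma card_sphere_escape:
  assumes "u < n" "\<not> P u" "s \<le> d"
    and esc: "\<And>x. x < n \<Longrightarrow> \<not> P x \<Longrightarrow> card {y. y < n \<and> E x y \<and> P y} \<le> \<beta>"
  shows "real (card {y \<in> sphere u s. P y}) \<le> kk s * real \<beta> * recip_sum s"
  using \<open>s \<le> d\<close>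
proof (induction s)
  case 0
  have "{y \<in> sphere u 0. P y} = {}"
    using assms(1,2) dst_eq_0_iff[OF assms(1)] by (auto simp: sphere_def)
  then show ?case by (simp only: card.empty) (simp add: recip_sum_def)
next
  case (Suc s)
  let ?B = "\<lambda>s. {y \<in> sphere u s. P y}"
  have "card (?B (Suc s)) * c (Suc s) = (\<Sum>y\<in>?B (Suc s). card {x \<in> sphere u s. E x y})"
    using edges_down[OF assms(1)] by simp
  also have "\<dots> = (\<Sum>x\<in>sphere u s. card {y \<in> ?B (Suc s). E x y})"
    by (rule double_counting[symmetric]) auto
  \<comment> \<open>From a vertex already in \<open>P\<close> all \<open>b s\<close> upward edges
    may end in \<open>P\<close>; from any other vertex at most \<open>\<beta>\<close> do.\<close>
  also have "\<dots> \<le> (\<Sum>x\<in>sphere u s. (if P x then b s else 0) + \<beta>)"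
  proof (intro sum_mono)
    fix x assume x: "x \<in> sphere u s"
    show "card {y \<in> ?B (Suc s). E x y} \<le> (if P x then b s else 0) + \<beta>"
    proof (cases "P x")
      case True
      have "card {y \<in> ?B (Suc s). E x y} \<le> card {y \<in> sphere u (Suc s). E x y}"
        by (intro card_mono) auto
      then show ?thesis using edges_up[OF assms(1) x] True by simp
    next
      case False
      have "card {y \<in> ?B (Suc s). E x y} \<le> card {y. y < n \<and> E x y \<and> P y}"
        by (intro card_mono) (auto simp: sphere_def)
      also have "\<dots> \<le> \<beta>" using x False by (intro esc) (auto simp: sphere_def)
      finally show ?thesis by simp
    qed
  qed
  also have "\<dots> = card (?B s) * b s + ksize s * \<beta>"
    using card_sphere[OF assms(1)] by (simp add: sum.distrib sum.If_cases Int_def)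
  finally have "real (card (?B (Suc s)) * c (Suc s)) \<le> real (card (?B s) * b s + ksize s * \<beta>)"
    by (rule of_nat_mono)
  then have "real (card (?B (Suc s))) * c (Suc s) \<le> real (card (?B s)) * b s + kk s * \<beta>"
    by simp
  also have "\<dots> \<le> kk s * real \<beta> * recip_sum s * b s + kk s * \<beta>"
    using Suc by (intro add_mono mult_right_mono) auto
  also have "\<dots> = (kk s * b s) * (real \<beta> * recip_sum (Suc s))"
    using b_pos[of s] Suc.prems by (simp add: recip_sum_def field_simps)
  also have "kk s * b s = kk (Suc s) * c (Suc s)"
    using ksize_Suc[of s] by (metis of_nat_mult)
  finally have "real (card (?B (Suc s))) * c (Suc s) \<le> (kk (Suc s) * real \<beta> * recip_sum (Suc s)) * c (Suc s)"
    by (simp add: mult_ac)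
  then show ?case using c_pos[OF Suc.prems] by simp
qed

text \<open>An edge changes the distance to \<open>w\<close> by at most 1, so only a vertex at
  distance exactly \<open>j\<close> can leave the ball in one step.\<close>

lemma card_far_neighbours:
  assumes "x < n" "w < n" "dst x w \<le> j"
  shows "card {y. y < n \<and> E x y \<and> j < dst y w} \<le> b j"
proof (cases "dst x w = j")
  case True
  have "card {y. y < n \<and> E x y \<and> j < dst y w} \<le> card {y. y < n \<and> E x y \<and> dst w y = Suc j}"
  proof (intro card_mono)
    show "{y. y < n \<and> E x y \<and> j < dst y w} \<subseteq> {y. y < n \<and> E x y \<and> dst w y = Suc j}"
      using dst_step(3)[OF assms(2), of x] True dst_sym by fastforce
  qed auto
  then show ?thesis using card_b[OF assms(2,1), of j] True dst_sym by simp
next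
  case False
  have "{y. y < n \<and> E x y \<and> j < dst y w} = {}"
    using dst_step(3)[OF assms(2), of x] False assms(3) by fastforce
  then show ?thesis by (simp only: card.empty)
qed

lemma card_near_neighbours:
  assumes "x < n" "w < n" "t < dst x w"
  shows "card {y. y < n \<and> E x y \<and> dst y w \<le> t} \<le> c (Suc t)"
proof (cases "dst x w = Suc t")
  case True
  have "card {y. y < n \<and> E x y \<and> dst y w \<le> t} \<le> card {y. y < n \<and> E x y \<and> dst w y = t}"
  proof (intro card_mono)
    show "{y. y < n \<and> E x y \<and> dst y w \<le> t} \<subseteq> {y. y < n \<and> E x y \<and> dst w y = t}"
      using dst_step(4)[OF assms(2), of x] True dst_sym by fastforce
  qed auto
  then show ?thesis using card_c[OF assms(2,1), of t] True dst_sym by simp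
next
  case False
  have "{y. y < n \<and> E x y \<and> dst y w \<le> t} = {}"
    using dst_step(4)[OF assms(2), of x] False assms(3) by fastforce
  then show ?thesis by (simp only: card.empty)
qed

text \<open>The escape bound fixes \<open>w\<close> and varies the end of the geodesic, whereas here
  the end \<open>v\<close> is fixed. Counting pairs in \<open>sphere u i\<close> times
  \<open>sphere u j\<close> exchanges the roles, because the count does not depend on the choice of
  \<open>v\<close> in its sphere.\<close>

lemma card_sphere_far:
  assumes "u < n" "v < n" "i \<le> d" "j \<le> d" "dst u v = i"
  shows "real (card {w \<in> sphere u j. j < dst v w}) \<le> kk j * real (b j) * recip_sum i"
proof -
  let ?q = "card {w \<in> sphere u j. j < dst v w}"
  have "ksize i * ?q = (\<Sum>v'\<in>sphere u i. card {w \<in> sphere u j. j < dst v' w})"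
  proof -
    have "card {w \<in> sphere u j. j < dst v' w} = ?q" if "v' \<in> sphere u i" for v'
      using card_pair_unique[of u v' u v "\<lambda>x y. x = j \<and> j < y"] assms that
      by (auto simp: sphere_def)
    then show ?thesis using card_sphere[OF assms(1), of i] by simp
  qed
  also have "\<dots> = (\<Sum>w\<in>sphere u j. card {v' \<in> sphere u i. j < dst v' w})"
    by (rule double_counting) auto
  finally have "real (ksize i * ?q) = (\<Sum>w\<in>sphere u j. real (card {v' \<in> sphere u i. j < dst v' w}))"
    by simp
  also have "\<dots> \<le> (\<Sum>w\<in>sphere u j. kk i * real (b j) * recip_sum i)"
  proof (intro sum_mono)
    fix w assume "w \<in> sphere u j"
    then have w: "w < n" "dst u w = j" by (auto simp: sphere_def)
    show "real (card {v' \<in> sphere u i. j < dst v' w}) \<le> kk i * real (b j) * recip_sum i"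
    proof (rule card_sphere_escape[OF assms(1) _ assms(3)])
      show "\<not> j < dst u w" using w by simp
      show "card {y. y < n \<and> E x y \<and> j < dst y w} \<le> b j" if "x < n" "\<not> j < dst x w" for x
        using card_far_neighbours[OF that(1) w(1), of j] that by simp
    qed
  qed
  also have "\<dots> = kk i * (kk j * real (b j) * recip_sum i)"
    using card_sphere[OF assms(1), of j] by simp
  finally show ?thesis using ksize_pos[OF assms(3)] by simp
qed

section \<open>Growth of spheres and lower bounds for \<open>b\<close> and \<open>c\<close>\<close>

lemma card_ball:
  assumes "u < n"
  shows "card (ball u j) = (\<Sum>i\<le>j. ksize i)"
proof -
  have "ball u j = (\<Union>i\<in>{..j}. sphere u i)" by (auto simp: ball_def sphere_def)
  also have "card \<dots> = (\<Sum>i\<le>j. card (sphere u i))"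
    by (intro card_UN_disjoint) (auto simp: sphere_def)
  finally show ?thesis using card_sphere[OF assms] by simp
qed

text \<open>Average over all \<open>v'\<close> in \<open>sphere u i\<close>: each \<open>w\<close>
  in the ball around \<open>u\<close> is counted at most as often as the ball around
  \<open>w\<close> has elements.\<close>

lemma card_ball_Int_ball:
  assumes "u < n" "v < n" "dst u v = i"
  shows "ksize i * card (ball u j \<inter> ball v j) \<le> (\<Sum>i\<le>j. ksize i)\<^sup>2"
proof -
  have "ksize i * card (ball u j \<inter> ball v j) = (\<Sum>v'\<in>sphere u i. card {w \<in> ball u j. dst v' w \<le> j})"
  proof -
    have "card {w \<in> ball u j. dst v' w \<le> j} = card (ball u j \<inter> ball v j)" if "v' \<in> sphere u i" for v'
      using card_pair_unique[of u v' u v "\<lambda>x y. x \<le> j \<and> y \<le> j"] assms that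
      by (auto simp: sphere_def ball_def Int_def conj_ac)
    then show ?thesis using card_sphere[OF assms(1), of i] by simp
  qed
  also have "\<dots> = (\<Sum>w\<in>ball u j. card {v' \<in> sphere u i. dst v' w \<le> j})"
    by (rule double_counting) auto
  also have "\<dots> \<le> (\<Sum>w\<in>ball u j. card (ball w j))"
    by (intro sum_mono card_mono) (auto simp: ball_def sphere_def dst_sym)
  also have "\<dots> = (\<Sum>w\<in>ball u j. \<Sum>i\<le>j. ksize i)"
    by (intro sum.cong refl card_ball) (auto simp: ball_def)
  also have "\<dots> = (\<Sum>i\<le>j. ksize i)\<^sup>2"
    using card_ball[OF assms(1), of j] by (simp add: power2_eq_square)
  finally show ?thesis .
qed

lemma ksize_growth:
  assumes "j < d" "real (b j) \<ge> C * real (c (Suc j))"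
  shows "kk (Suc j) \<ge> C * kk j"
proof -
  have "C * kk j * real (c (Suc j)) \<le> kk j * real (b j)"
    using mult_right_mono[OF assms(2), of "kk j"] by (simp add: mult_ac)
  also have "\<dots> = kk (Suc j) * real (c (Suc j))"
    using ksize_Suc[of j] by (metis of_nat_mult)
  finally show ?thesis using c_pos[of j] assms(1) by simp
qed

text \<open>A geometric series, since the spheres grow at least by the factor
  \<open>C\<close>.\<close>

lemma ball_size_le:
  assumes "j < d" "C > 1" "\<And>i. i \<le> j \<Longrightarrow> real (b i) \<ge> C * real (c (Suc i))"
  shows "(C - 1) * real (\<Sum>i\<le>j. ksize i) \<le> C * kk j"
  using assms(1,3)
proof (induction j)
  case 0
  then show ?case using assms(2) by (simp add: ksize_0)
next
  case (Suc j)
  have "(C - 1) * real (\<Sum>i\<le>j. ksize i) \<le> C * kk j" using Suc by simp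
  moreover have "C * kk j \<le> kk (Suc j)" using ksize_growth[of j C] Suc.prems by simp
  ultimately show ?case by (simp add: algebra_simps)
qed

text \<open>Place \<open>u\<close> on a geodesic from \<open>v\<close> to \<open>v'\<close> of
  length \<open>Suc j\<close>. Each vertex of \<open>sphere u j\<close> is farther than
  \<open>j\<close> from \<open>v\<close>, or from \<open>v'\<close>, or lies in both balls of radius
  \<open>j\<close>; the escape bound controls the first two sets, ball growth the third.\<close>

lemma b_recip_sum_ge:
  assumes "j < d" "C > 1" "i + i' = Suc j"
    and ratio: "\<And>i. i \<le> j \<Longrightarrow> real (b i) \<ge> C * real (c (Suc i))"
  shows "1 - C / (C - 1)\<^sup>2 \<le> real (b j) * (recip_sum i + recip_sum i')"
proof -
  obtain v v' where v: "v < n" "v' < n" "dst v v' = Suc j"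
    using pair_at_distance[of "Suc j"] assms(1) by auto
  obtain u where u: "u < n" "dst v u = i" "dst u v' = i'"
    by (rule intermediate_vertex[OF v(1,2), of i i']) (use v assms in auto)
  let ?B = "real (\<Sum>i\<le>j. ksize i)"
  let ?F = "\<lambda>v. {w \<in> sphere u j. j < dst v w}"
  have "sphere u j \<subseteq> (?F v \<union> ?F v') \<union> (ball v j \<inter> ball v' j)"
    by (auto simp: sphere_def ball_def)
  then have "card (sphere u j) \<le> card ((?F v \<union> ?F v') \<union> (ball v j \<inter> ball v' j))"
    by (intro card_mono) auto
  also have "\<dots> \<le> card (?F v) + card (?F v') + card (ball v j \<inter> ball v' j)"
    using card_Un_le[of "?F v \<union> ?F v'" "ball v j \<inter> ball v' j"] card_Un_le[of "?F v" "?F v'"] by linarith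
  finally have "kk j \<le> real (card (?F v)) + real (card (?F v')) + real (card (ball v j \<inter> ball v' j))"
    using card_sphere[OF u(1), of j] by linarith
  moreover have "real (card (?F v)) \<le> kk j * real (b j) * recip_sum i"
    using card_sphere_far[of u v i j] u v assms dst_sym by simp
  moreover have "real (card (?F v')) \<le> kk j * real (b j) * recip_sum i'"
    using card_sphere_far[of u v' i' j] u v assms dst_sym by simp
  moreover have "real (card (ball v j \<inter> ball v' j)) \<le> kk j * (C / (C - 1)\<^sup>2)"
  proof -
    \<comment> \<open>The intersection has at most \<open>?B\<^sup>2 / kk (Suc j)\<close> elements,
      where \<open>?B \<le> C / (C - 1) * kk j\<close> and
      \<open>kk (Suc j) \<ge> C * kk j\<close>.\<close>
    let ?q = "real (card (ball v j \<inter> ball v' j))"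
    have kpos: "kk j > 0" using ksize_pos[of j] assms(1) by simp
    have "C * kk j * ?q \<le> kk (Suc j) * ?q"
      using ksize_growth[of j C] assms by (intro mult_right_mono) auto
    also have "\<dots> \<le> ?B\<^sup>2"
      using of_nat_mono[OF card_ball_Int_ball[OF v, of j], where 'a = real] by simp
    finally have "(C - 1)\<^sup>2 * (C * kk j * ?q) \<le> (C - 1)\<^sup>2 * ?B\<^sup>2"
      by (rule mult_left_mono) simp
    also have "\<dots> = ((C - 1) * ?B)\<^sup>2" by (simp add: power_mult_distrib)
    also have "\<dots> \<le> (C * kk j)\<^sup>2"
      using ball_size_le[OF assms(1,2) ratio] assms(2) by (intro power_mono mult_nonneg_nonneg of_nat_0_le_iff) auto
    finally have "(C * kk j) * ((C - 1)\<^sup>2 * ?q) \<le> (C * kk j) * (C * kk j)"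
      by (simp only: power2_eq_square mult_ac)
    then have "(C - 1)\<^sup>2 * ?q \<le> C * kk j"
      using kpos assms(2) by (simp only: mult_le_cancel_left_pos mult_pos_pos)
    then show ?thesis using assms(2) by (simp add: field_simps)
  qed
  ultimately have "kk j \<le> kk j * (real (b j) * (recip_sum i + recip_sum i') + C / (C - 1)\<^sup>2)"
    by (simp add: algebra_simps)
  then show ?thesis using ksize_pos[of j] assms(1) by simp
qed

lemma recip_sum_le:
  assumes "s \<le> Suc m" "m < d"
  shows "recip_sum s \<le> real s / real (b m)"
proof -
  have "recip_sum s \<le> (\<Sum>r<s. 1 / real (b m))"
    unfolding recip_sum_def
  proof (intro sum_mono divide_left_mono)
    fix r assume "r \<in> {..<s}"
    then have "r \<le> m" "r < d" using assms by auto
    then show "real (b m) \<le> real (b r)" "0 < real (b r) * real (b m)"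
      using b_antimono[of r m] b_pos[of r] b_pos[of m] assms by auto
  qed auto
  then show ?thesis by simp
qed

text \<open>Split the geodesic of length \<open>Suc j\<close> near its middle. Both parts have at
  most \<open>Suc (j div 2)\<close> steps, so every \<open>b r\<close> in the two reciprocal sums is
  at least \<open>b (j div 2)\<close>, and the sums have \<open>Suc j\<close> terms
  together.\<close>

lemma b_halving:
  assumes "j < d" "C > 2"
    and ratio: "\<And>i. i \<le> j \<Longrightarrow> real (b i) \<ge> C * real (c (Suc i))"
  shows "real (b j) \<ge> (1 - 1 / (C - 2)) * real (b (j div 2)) / real (Suc j)"
proof -
  define m where "m = j div 2"
  have m: "m < d" using assms(1) by (simp add: m_def)
  have bm: "real (b m) > 0" using b_pos[OF m] by simp
  have "C / (C - 1)\<^sup>2 \<le> 1 / (C - 2)"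
  proof -
    have "C * (C - 2) \<le> (C - 1)\<^sup>2" by (simp add: power2_eq_square algebra_simps)
    then show ?thesis using assms(2) by (simp add: divide_simps)
  qed
  then have "1 - 1 / (C - 2) \<le> 1 - C / (C - 1)\<^sup>2" by simp
  also have "\<dots> \<le> real (b j) * (recip_sum (Suc m) + recip_sum (j - m))"
    using assms by (intro b_recip_sum_ge) (auto simp: m_def)
  also have "\<dots> \<le> real (b j) * (real (Suc m) / real (b m) + real (j - m) / real (b m))"
    using m by (intro mult_left_mono add_mono recip_sum_le) (auto simp: m_def)
  also have "\<dots> = real (b j) * real (Suc j) / real (b m)"
    by (simp add: add_divide_distrib[symmetric] m_def of_nat_diff)
  finally show ?thesis using bm by (simp add: m_def field_simps)
qed

text \<open>Halving \<open>j\<close> down to 0 costs a factor \<open>Suc j \<le> d\<close> each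
  time, except that the step from 1 to 0 costs only 2.\<close>

lemma b_lower_bound:
  assumes "d \<ge> 1" "C \<ge> 3" "j < d" "j < 2 ^ Suc m"
    and ratio: "\<And>i. i \<le> j \<Longrightarrow> real (b i) \<ge> C * real (c (Suc i))"
  shows "real (b j) \<ge> (1 - 1 / (C - 2)) ^ Suc m * real (b 0) / (2 * real d ^ m)"
  using assms(3-5)
proof (induction m arbitrary: j)
  case 0
  then consider "j = 0" | "j = 1" by force
  then show ?case
  proof cases
    case 1
    have "0 \<le> 1 / (C - 2)" using assms by simp
    then have "(1 - 1 / (C - 2)) * real (b 0) \<le> 2 * real (b 0)"
      by (intro mult_right_mono) linarith+
    then show ?thesis using 1 by simp
  next
    case 2
    then show ?thesis using b_halving[of j C] 0 assms by simp
  qed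
next
  case (Suc m)
  let ?q = "1 - 1 / (C - 2)"
  have q: "0 \<le> ?q" using assms by (auto simp: field_simps)
  have "?q ^ Suc (Suc m) * real (b 0) / (2 * real d ^ Suc m) =
      ?q * (?q ^ Suc m * real (b 0) / (2 * real d ^ m)) / real d"
    by (simp add: mult_ac)
  also have "\<dots> \<le> ?q * real (b (j div 2)) / real d"
    using Suc.prems Suc.IH[of "j div 2"] q by (intro divide_right_mono mult_left_mono) auto
  also have "\<dots> \<le> ?q * real (b (j div 2)) / real (Suc j)"
    using Suc.prems q assms by (intro divide_left_mono mult_nonneg_nonneg) auto
  also have "\<dots> \<le> real (b j)" using Suc.prems assms by (intro b_halving) auto
  finally show ?case .
qed

text \<open>Count pairs of a neighbour \<open>y'\<close> of \<open>x\<close> and a \<open>w\<close>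
  in \<open>sphere x t\<close> whose distance is not \<open>t\<close>: for each \<open>w\<close>
  these are the \<open>b t\<close> neighbours one step farther from \<open>w\<close> and the
  \<open>c t\<close> one step closer.\<close>

lemma card_sphere_diff_adjacent:
  assumes "E x y" "t \<le> d" "1 \<le> t"
  shows "b 0 * card (sphere x t - sphere y t) = ksize t * (b t + c t)"
proof -
  have xy: "x < n" "y < n" "dst x y = 1" using assms edge_less dst_edge by auto
  have N: "{y. y < n \<and> E x y} = sphere x 1"
    using dst_edge edge_of_dst_1 xy by (auto simp: sphere_def)
  have "b 0 * card (sphere x t - sphere y t) = (\<Sum>y'\<in>sphere x 1. card {w \<in> sphere x t. dst y' w \<noteq> t})"
  proof -
    have "card {w \<in> sphere x t. dst y' w \<noteq> t} = card (sphere x t - sphere y t)" if "y' \<in> sphere x 1" for y'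
    proof -
      have "sphere x t - sphere y t = {w. w < n \<and> dst x w = t \<and> dst y w \<noteq> t}"
        by (auto simp: sphere_def)
      then show ?thesis
        using card_pair_unique[of x y' x y "\<lambda>x y. x = t \<and> y \<noteq> t"] xy that
        by (auto simp: sphere_def)
    qed
    then show ?thesis using degree[OF xy(1)] N by simp
  qed
  also have "\<dots> = (\<Sum>w\<in>sphere x t. card {y' \<in> sphere x 1. dst y' w \<noteq> t})"
    by (rule double_counting) auto
  also have "\<dots> = (\<Sum>w\<in>sphere x t. b t + c t)"
  proof (intro sum.cong refl)
    fix w assume "w \<in> sphere x t"
    then have w: "w < n" "dst w x = t" by (auto simp: sphere_def dst_sym)
    obtain s where s: "t = Suc s" using assms by (cases t) auto
    have eq: "{y' \<in> sphere x 1. dst y' w \<noteq> t} =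
        {u. u < n \<and> E x u \<and> dst w u = Suc t} \<union> {u. u < n \<and> E x u \<and> dst w u = s}"
    proof (rule Set.set_eqI)
      fix z
      have "E x z \<Longrightarrow> dst z w \<noteq> t \<longleftrightarrow> dst w z = Suc t \<or> dst w z = s"
        using dst_step(1,2)[OF w(1), of x z] w s dst_sym[of z w] by linarith
      then show "z \<in> {y' \<in> sphere x 1. dst y' w \<noteq> t} \<longleftrightarrow>
        z \<in> {u. u < n \<and> E x u \<and> dst w u = Suc t} \<union> {u. u < n \<and> E x u \<and> dst w u = s}"
        unfolding N[symmetric] by blast
    qed
    have B: "card {u. u < n \<and> E x u \<and> dst w u = Suc t} = b t"
      by (rule card_b[OF w(1) xy(1) w(2)])
    have "dst w x = Suc s" using w(2) s by (rule trans)
    then have C: "card {u. u < n \<and> E x u \<and> dst w u = s} = c t"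
      unfolding s by (rule card_c[OF w(1) xy(1)])
    show "card {y' \<in> sphere x 1. dst y' w \<noteq> t} = b t + c t"
      unfolding eq B[symmetric] C[symmetric] by (rule card_Un_disjoint) (auto simp: s)
  qed
  also have "\<dots> = ksize t * (b t + c t)" using card_sphere[OF xy(1)] by simp
  finally show ?thesis .
qed

lemma card_sphere_diff:
  assumes "u < n" "w < n" "dst u w = m" "t \<le> d" "1 \<le> t"
  shows "b 0 * card (sphere u t - sphere w t) \<le> m * (ksize t * (b t + c t))"
  using assms(2,3)
proof (induction m arbitrary: w)
  case 0
  then have "w = u" using dst_eq_0_iff assms(1) by auto
  then show ?case by simp
next
  case (Suc m)
  obtain x where x: "x < n" "dst u x = m" "dst x w = 1"
    by (rule intermediate_vertex[OF assms(1) Suc.prems(1), of m 1]) (use Suc in auto)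
  have e: "E x w" using edge_of_dst_1 x Suc by blast
  have "card (sphere u t - sphere w t) \<le> card ((sphere u t - sphere x t) \<union> (sphere x t - sphere w t))"
    by (intro card_mono) auto
  also have "\<dots> \<le> card (sphere u t - sphere x t) + card (sphere x t - sphere w t)"
    by (rule card_Un_le)
  finally have "b 0 * card (sphere u t - sphere w t) \<le>
      b 0 * card (sphere u t - sphere x t) + b 0 * card (sphere x t - sphere w t)"
    by (metis mult_le_mono2 distrib_left)
  also have "\<dots> \<le> m * (ksize t * (b t + c t)) + ksize t * (b t + c t)"
    using Suc.IH[OF x(1,2)] card_sphere_diff_adjacent[OF e assms(4,5)] by simp
  finally show ?case by simp
qed

text \<open>Geodesics of length \<open>t\<close> from \<open>u\<close> start outside the ball of
  radius \<open>t\<close> around \<open>w\<close> and enter it only through \<open>c (Suc t)\<close>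
  edges per vertex. Yet most of them must end in it, since \<open>sphere u t\<close> differs little
  from \<open>sphere w t\<close>.\<close>

lemma c_lower_bound:
  assumes "1 \<le> t" "t < d"
  shows "real (c (Suc t)) \<ge>
    (1 - real (Suc t) * (real (b t) + real (c t)) / real (b 0)) * real (b (t - 1)) / real t"
proof -
  obtain u w where uw: "u < n" "w < n" "dst u w = Suc t"
    using pair_at_distance[of "Suc t"] assms by auto
  have k: "real (b 0) > 0" "kk t > 0" "real (b (t - 1)) > 0"
    using b_pos assms ksize_pos by auto
  have "real (card {v \<in> sphere u t. dst v w \<le> t}) \<le> kk t * real (c (Suc t)) * recip_sum t"
  proof (rule card_sphere_escape[OF uw(1)])
    show "card {y. y < n \<and> E x y \<and> dst y w \<le> t} \<le> c (Suc t)" if "x < n" "\<not> dst x w \<le> t" for x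
      using card_near_neighbours[OF that(1) uw(2), of t] that by simp
  qed (use uw assms in auto)
  also have "\<dots> \<le> kk t * real (c (Suc t)) * (real t / real (b (t - 1)))"
    using assms by (intro mult_left_mono recip_sum_le) auto
  finally have 1: "real (card {v \<in> sphere u t. dst v w \<le> t}) \<le> kk t * (real (c (Suc t)) * real t / real (b (t - 1)))"
    by simp
  have "card (sphere u t) \<le> card ({v \<in> sphere u t. dst v w \<le> t} \<union> (sphere u t - sphere w t))"
    by (intro card_mono) (auto simp: sphere_def dst_sym)
  also have "\<dots> \<le> card {v \<in> sphere u t. dst v w \<le> t} + card (sphere u t - sphere w t)"
    by (rule card_Un_le)
  finally have 2: "kk t \<le> real (card {v \<in> sphere u t. dst v w \<le> t}) + real (card (sphere u t - sphere w t))"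
    using card_sphere[OF uw(1), of t] by linarith
  have "real (b 0 * card (sphere u t - sphere w t)) \<le> real (Suc t * (ksize t * (b t + c t)))"
    using card_sphere_diff[OF uw, of t] assms by (intro of_nat_mono) auto
  then have 3: "real (card (sphere u t - sphere w t)) \<le> kk t * (real (Suc t) * (real (b t) + real (c t)) / real (b 0))"
    using k by (simp add: field_simps)
  have "kk t * 1 \<le> kk t * (real (c (Suc t)) * real t / real (b (t - 1)) + real (Suc t) * (real (b t) + real (c t)) / real (b 0))"
    unfolding distrib_left[of "kk t"] using 1 2 3 by linarith
  then have "1 \<le> real (c (Suc t)) * real t / real (b (t - 1)) + real (Suc t) * (real (b t) + real (c t)) / real (b 0)"
    using k by (simp only: mult_le_cancel_left_pos)
  then have "1 - real (Suc t) * (real (b t) + real (c t)) / real (b 0) \<le> real (c (Suc t)) * real t / real (b (t - 1))"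
    by linarith
  then show ?thesis using k assms by (simp only: pos_le_divide_eq pos_divide_le_eq of_nat_0_less_iff)
qed

section \<open>Eigenvalues\<close>

text \<open>Maximum principle: the neighbours of a vertex with maximal value have that value too,
  and connectedness spreads it.\<close>

lemma harmonic_constant:
  fixes x :: "nat \<Rightarrow> real"
  assumes harm: "\<And>v. v < n \<Longrightarrow> (\<Sum>w | w < n \<and> E v w. x w) = real (b 0) * x v"
    and "u < n" "v < n"
  shows "x u = x v"
proof -
  define M where "M = Max (x ` {..<n})"
  have le_M: "x w \<le> M" if "w < n" for w unfolding M_def using that by (intro Max_ge) auto
  have "M \<in> x ` {..<n}" unfolding M_def using n_pos by (intro Max_in) auto
  then obtain z where z: "z < n" "x z = M" by auto
  have nbr: "x w = M" if "v < n" "x v = M" "E v w" for v w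
  proof -
    have "(\<Sum>w | w < n \<and> E v w. M - x w) = real (card {w. w < n \<and> E v w}) * M - real (b 0) * x v"
      using harm[OF that(1)] by (simp add: sum_subtractf)
    also have "\<dots> = 0" using degree[OF that(1)] that(2) by simp
    finally have "\<forall>w\<in>{w. w < n \<and> E v w}. M - x w = 0"
      by (subst (asm) sum_nonneg_eq_0_iff) (auto simp: le_M)
    then show ?thesis using that(3) edge_less by auto
  qed
  have "x w = M" if "(E ^^ m) z w" for m w
    using that
  proof (induction m arbitrary: w)
    case 0 then show ?case using z by simp
  next
    case (Suc m)
    then obtain y where "(E ^^ m) z y" "E y w" by (auto elim: relpowp_Suc_E)
    then show ?case using Suc.IH nbr edge_less by blast
  qed
  then show ?thesis using walk_exists[OF z(1)] assms(2,3) by metis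
qed

text \<open>\<open>c 0\<close> is unconstrained, hence the case distinction.\<close>

definition c' :: "nat \<Rightarrow> real" where
  "c' i = (if i = 0 then 0 else real (c i))"

text \<open>The spherical mean of \<open>x\<close>. At radius \<open>Suc d\<close> the sphere is
  empty and the quotient is 0; its coefficient in the recurrence is \<open>b d = 0\<close>.\<close>

definition avg :: "(nat \<Rightarrow> real) \<Rightarrow> nat \<Rightarrow> nat \<Rightarrow> real" where
  "avg x u i = (\<Sum>w\<in>sphere u i. x w) / kk i"

lemma sum_sphere_neighbours:
  fixes x :: "nat \<Rightarrow> real"
  assumes "u < n"
  shows "(\<Sum>v\<in>sphere u i. \<Sum>w | w < n \<and> E v w. x w) =
    (\<Sum>m\<le>d. real (inum m i) * (\<Sum>w\<in>sphere u m. x w))"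
proof -
  have "(\<Sum>v\<in>sphere u i. \<Sum>w | w < n \<and> E v w. x w) =
      (\<Sum>v\<in>sphere u i. \<Sum>w<n. if E v w then x w else 0)"
    by (intro sum.cong[OF refl]) (simp add: sum.If_cases Int_def)
  also have "\<dots> = (\<Sum>w<n. \<Sum>v\<in>sphere u i. if E v w then x w else 0)"
    by (rule sum.swap)
  also have "\<dots> = (\<Sum>w<n. real (inum (dst u w) i) * x w)"
  proof (intro sum.cong refl)
    fix w assume "w \<in> {..<n}"
    then have w: "w < n" by simp
    have "sphere u i \<inter> {v. E v w} = {v. v < n \<and> E w v \<and> dst u v = i}"
      using edge_commute by (auto simp: sphere_def)
    then show "(\<Sum>v\<in>sphere u i. if E v w then x w else 0) = real (inum (dst u w) i) * x w"
      using card_neighbours_at[OF assms w, of i] by (simp add: sum.If_cases)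
  qed
  also have "\<dots> = (\<Sum>m\<le>d. \<Sum>w\<in>{w\<in>{..<n}. dst u w = m}. real (inum (dst u w) i) * x w)"
    using dst_le_diameter[OF assms] by (intro sum.group[symmetric]) auto
  also have "\<dots> = (\<Sum>m\<le>d. real (inum m i) * (\<Sum>w\<in>sphere u m. x w))"
    unfolding sum_distrib_left sphere_def by (intro sum.cong) auto
  finally show ?thesis .
qed

text \<open>Summing the equation over a sphere gives the transposed intersection matrix; dividing by
  sphere sizes and using \<open>ksize_Suc\<close> turns its rows into \<open>c i, a i, b i\<close>.
  The constant \<open>s\<close> survives averaging.\<close>

lemma avg_recurrence:
  fixes x :: "nat \<Rightarrow> real"
  assumes eig: "\<And>v. v < n \<Longrightarrow> (\<Sum>w | w < n \<and> E v w. x w) = \<theta> * x v + s"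
    and "u < n" "i \<le> d"
  shows "c' i * avg x u (i - 1) + (real (b 0) - c' i - real (b i)) * avg x u i + real (b i) * avg x u (Suc i)
     = \<theta> * avg x u i + s"
proof -
  let ?g = "avg x u"
  have kpos: "kk m > 0" if "m \<le> d" for m using ksize_pos[OF that] by simp
  have S: "(\<Sum>w\<in>sphere u m. x w) = kk m * ?g m" if "m \<le> d" for m
    using kpos[OF that] by (simp add: avg_def)
  have kS: "kk (Suc m) * real (c (Suc m)) = kk m * real (b m)" for m
    using ksize_Suc[of m] by (metis of_nat_mult)
  have "kk i * (\<theta> * ?g i + s) = (\<Sum>v\<in>sphere u i. \<theta> * x v + s)"
    using S[OF assms(3)] card_sphere[OF assms(2), of i]
    by (simp add: sum.distrib sum_distrib_left[symmetric] algebra_simps)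
  also have "\<dots> = (\<Sum>v\<in>sphere u i. \<Sum>w | w < n \<and> E v w. x w)"
    using eig by (intro sum.cong refl) (auto simp: sphere_def)
  also have "\<dots> = (\<Sum>m\<le>d. real (inum m i) * (kk m * ?g m))"
    unfolding sum_sphere_neighbours[OF assms(2)] by (intro sum.cong refl) (simp add: S)
  \<comment> \<open>For \<open>i = 0\<close> the first two cases coincide by truncated subtraction,
    but then \<open>c' i = 0\<close>.\<close>
  also have "\<dots> = (\<Sum>m\<le>d. (if m = i - 1 then kk i * c' i * ?g (i - 1) else 0) +
      (if m = i then kk i * real (a i) * ?g i else 0) +
      (if m = Suc i then kk i * real (b i) * ?g (Suc i) else 0))"
  proof (intro sum.cong refl)
    fix m assume "m \<in> {..d}"
    show "real (inum m i) * (kk m * ?g m) = (if m = i - 1 then kk i * c' i * ?g (i - 1) else 0) +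
      (if m = i then kk i * real (a i) * ?g i else 0) +
      (if m = Suc i then kk i * real (b i) * ?g (Suc i) else 0)"
    proof (cases "i = Suc m")
      case True
      then show ?thesis using kS[of m] by (simp add: inum_def c'_def mult_ac)
    next
      case False
      then show ?thesis using kS[of i]
        by (cases "m = i"; cases "m = Suc i") (auto simp: inum_def c'_def mult_ac)
    qed
  qed
  also have "\<dots> = kk i * c' i * ?g (i - 1) + kk i * real (a i) * ?g i + kk i * real (b i) * ?g (Suc i)"
  proof -
    have "Suc i \<le> d \<or> b i = 0" using b_diameter assms(3) by (cases "i = d") auto
    then show ?thesis using assms(3) by (auto simp: sum.distrib)
  qed
  also have "\<dots> = kk i * (c' i * ?g (i - 1) + real (a i) * ?g i + real (b i) * ?g (Suc i))"
    by (simp add: algebra_simps)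
  finally have "c' i * ?g (i - 1) + real (a i) * ?g i + real (b i) * ?g (Suc i) = \<theta> * ?g i + s"
    using kpos[OF assms(3)] by simp
  moreover have "real (a i) = real (b 0) - c' i - real (b i)"
    using degree_split[of i] degree_split_0 assms(3) by (cases "i = 0") (auto simp: c'_def)
  ultimately show ?thesis by simp
qed

text \<open>Subtracting consecutive equations cancels \<open>s\<close> and leaves the
  \<open>d\<close> by \<open>d\<close> tridiagonal matrix.\<close>

lemma difference_recurrence:
  fixes x :: "nat \<Rightarrow> real"
  assumes eig: "\<And>v. v < n \<Longrightarrow> (\<Sum>w | w < n \<and> E v w. x w) = \<theta> * x v + s"
    and "u < n" "i < d"
  defines "D \<equiv> \<lambda>i. avg x u i - avg x u (Suc i)"
  shows "\<theta> * D i = c' i * D (i - 1) + (real (b 0) - real (b i) - c' (Suc i)) * D i + real (b (Suc i)) * D (Suc i)"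
proof -
  define y where "y = D (i - 1)"
  have "c' i * avg x u (i - 1) = c' i * (y + avg x u i)"
    by (cases i) (simp_all add: c'_def D_def y_def)
  then show ?thesis
    unfolding y_def[symmetric]
    using avg_recurrence[OF eig assms(2), of i] avg_recurrence[OF eig assms(2), of "Suc i"] assms(3)
    by (simp add: D_def algebra_simps)
qed

text \<open>The cut is at \<open>t\<close>; \<open>\<tau>\<close> bounds the small entries,
  \<open>\<mu>\<close> is the gap of the diagonal, and \<open>e\<close> is the ratio of the
  rescaling, which enlarges small entries and shrinks large ones.\<close>

lemma eigenvalue_bound:
  fixes x :: "nat \<Rightarrow> real" and e \<tau> \<mu> :: real
  assumes eig: "\<And>v. v < n \<Longrightarrow> (\<Sum>w | w < n \<and> E v w. x w) = \<theta> * x v + s"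
    and nonconst: "\<exists>v<n. x v \<noteq> x 0"
    and t: "1 \<le> t" "t \<le> d" and e: "e \<ge> 1"
    and ct: "real (c t) \<le> \<tau>" and bt: "real (b t) \<le> \<tau>"
    and \<mu>b: "\<mu> \<le> real (b (t - 1))" and \<mu>c: "t < d \<Longrightarrow> \<mu> \<le> real (c (Suc t))"
  shows "\<bar>\<theta>\<bar> \<le> real (b 0) - \<mu> + 3 * \<tau> * e + real (b 0) / e"
proof -
  let ?k = "real (b 0)"
  have \<tau>: "\<tau> \<ge> 0" using ct by linarith
  \<comment> \<open>Otherwise \<open>x\<close> would equal its mean over the neighbours everywhere,
    hence be constant. This \<open>u\<close> makes \<open>D 0\<close> nonzero.\<close>
  have "\<exists>u<n. avg x u 0 \<noteq> avg x u 1"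
  proof (rule ccontr)
    assume "\<not> ?thesis"
    then have same: "avg x u 0 = avg x u 1" if "u < n" for u using that by blast
    have "(\<Sum>w | w < n \<and> E v w. x w) = ?k * x v" if v: "v < n" for v
    proof -
      have "sphere v 0 = {v}" using v dst_eq_0_iff[OF v] by (auto simp: sphere_def)
      moreover have N: "sphere v 1 = {w. w < n \<and> E v w}"
        using dst_edge edge_of_dst_1 v by (auto simp: sphere_def)
      moreover have "ksize 1 = b 0" using card_sphere[OF v, of 1] degree[OF v] N by simp
      ultimately show ?thesis
        using same[OF v] b_pos[of 0] t by (simp add: avg_def ksize_0 field_simps)
    qed
    then have "x v = x 0" if "v < n" for v using harmonic_constant[of x v 0] that n_pos by blast
    then show False using nonconst by blast
  qed
  then obtain u where u: "u < n" "avg x u 0 \<noteq> avg x u 1" by blast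
  define D where "D i = avg x u i - avg x u (Suc i)" for i
  \<comment> \<open>Weights grow away from the cut, with value 1 at both \<open>t - 1\<close> and
    \<open>t\<close>. Hence \<open>c i\<close> before the cut and \<open>b (Suc i)\<close> after it
    are multiplied by \<open>e\<close>, the large entries by \<open>1 / e\<close>, and
    \<open>b t\<close>, \<open>c t\<close> at the cut by 1.\<close>
  define \<omega> where "\<omega> i = e ^ (if i < t then t - 1 - i else i - t)" for i
  define m where "m i = ?k - real (b i) - c' (Suc i)" for i
  have e_step: "z * e ^ j \<le> (\<tau> * e) * e ^ j" if "z \<le> \<tau>" "0 \<le> z" for z j
  proof -
    have "z * 1 \<le> \<tau> * e" using that e by (intro mult_mono) auto
    then show ?thesis using e by (intro mult_right_mono) auto
  qed
  have c_small: "c' i \<le> \<tau>" if "i \<le> t" for i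
    using c_mono[of i t] that t ct \<tau> by (auto simp: c'_def)
  have b_small: "real (b i) \<le> \<tau>" if "t \<le> i" "i \<le> d" for i
    using b_antimono[of t i] that bt by auto
  have b_le: "real (b i) \<le> ?k" if "i \<le> d" for i using b_antimono[of 0 i] that by simp
  have c_le: "c' i \<le> ?k" if "i \<le> d" for i using degree_split[of i] that by (auto simp: c'_def)
  have c_nonneg: "0 \<le> c' i" for i by (simp add: c'_def)
  have down: "z * e ^ j \<le> (?k / e) * e ^ Suc j" if "z \<le> ?k" for z j
    using that e by (simp add: mult_right_mono)
  have "\<exists>i<d. \<bar>\<theta> - m i\<bar> \<le> 2 * \<tau> * e + ?k / e"
  proof (rule weighted_gershgorin_tridiagonal[where l = c' and r = "\<lambda>i. real (b (Suc i))" and D = D and \<omega> = \<omega>])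
    fix i assume i: "i < d"
    show "\<theta> * D i = c' i * D (i - 1) + m i * D i + real (b (Suc i)) * D (Suc i)"
      using difference_recurrence[OF eig u(1) i] by (simp add: D_def m_def)
    show "\<omega> i > 0" using e by (simp add: \<omega>_def)
    have ke: "0 \<le> ?k / e * e ^ j" "0 \<le> \<tau> * e * e ^ j" for j using e \<tau> by auto
    \<comment> \<open>The side conditions \<open>t < i\<close> here and \<open>i < t\<close> in
      \<open>R\<close> ensure that no row has two large off-diagonal entries.\<close>
    have L: "c' i * \<omega> (i - 1) \<le> (\<tau> * e) * \<omega> i \<or> c' i * \<omega> (i - 1) \<le> (?k / e) * \<omega> i \<and> t < i"
    proof (cases "i \<le> t")
      case True
      consider "i = 0" | "i = t" | "0 < i" "i < t" using True by linarith
      then have "c' i * \<omega> (i - 1) \<le> (\<tau> * e) * \<omega> i"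
      proof cases
        case 1 then show ?thesis using ke t by (simp add: c'_def \<omega>_def)
      next
        case 2 then show ?thesis using e_step[OF c_small[OF True] c_nonneg, of 0] t by (simp add: \<omega>_def)
      next
        case 3
        then have "t - 1 - (i - 1) = Suc (t - 1 - i)" by simp
        then have "\<omega> (i - 1) = e * \<omega> i" using 3 by (simp add: \<omega>_def)
        moreover have "c' i * (e * \<omega> i) \<le> \<tau> * (e * \<omega> i)"
          using c_small[OF True] e by (intro mult_right_mono) (auto simp: \<omega>_def)
        ultimately show ?thesis by (simp add: mult_ac)
      qed
      then show ?thesis by simp
    next
      case False
      then have "i - t = Suc (i - 1 - t)" by simp
      then show ?thesis using down[OF c_le[of i], of "i - 1 - t"] False i by (auto simp: \<omega>_def)
    qed
    have R: "real (b (Suc i)) * \<omega> (Suc i) \<le> (\<tau> * e) * \<omega> i \<or> real (b (Suc i)) * \<omega> (Suc i) \<le> (?k / e) * \<omega> i \<and> i < t"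
    proof (cases "t \<le> Suc i")
      case True
      have "real (b (Suc i)) * \<omega> (Suc i) \<le> (\<tau> * e) * \<omega> i"
      proof (cases "t = Suc i")
        case True
        then show ?thesis using e_step[OF b_small[of "Suc i"], of 0] i by (simp add: \<omega>_def)
      next
        case False
        then have "Suc i - t = Suc (i - t)" "\<not> i < t" "\<not> Suc i < t" using True by auto
        then have "\<omega> (Suc i) = e * \<omega> i" by (simp add: \<omega>_def)
        moreover have "real (b (Suc i)) * (e * \<omega> i) \<le> \<tau> * (e * \<omega> i)"
          using b_small[OF True] i e by (intro mult_right_mono) (auto simp: \<omega>_def)
        ultimately show ?thesis by (simp add: mult_ac)
      qed
      then show ?thesis by simp
    next
      case False
      then have "t - 1 - i = Suc (t - 1 - Suc i)" by simp
      then show ?thesis using down[OF b_le[of "Suc i"], of "t - 1 - Suc i"] False i by (auto simp: \<omega>_def)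
    qed
    have "0 \<le> (?k / e) * \<omega> i" "0 \<le> (\<tau> * e) * \<omega> i" using ke by (auto simp: \<omega>_def)
    then have "c' i * \<omega> (i - 1) + real (b (Suc i)) * \<omega> (Suc i) \<le> 2 * ((\<tau> * e) * \<omega> i) + (?k / e) * \<omega> i"
      using L R by linarith
    then show "\<bar>c' i\<bar> * \<omega> (i - 1) + \<bar>real (b (Suc i))\<bar> * \<omega> (Suc i) \<le> (2 * \<tau> * e + ?k / e) * \<omega> i"
      using c_nonneg[of i] by (simp add: algebra_simps)
  next
    show "real (b (Suc (d - 1))) = 0" using b_diameter t by simp
    show "\<exists>i<d. D i \<noteq> 0" using u t by (intro exI[of _ 0]) (auto simp: D_def)
  qed
  then obtain i where i: "i < d" "\<bar>\<theta> - m i\<bar> \<le> 2 * \<tau> * e + ?k / e" by blast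
  have \<tau>e: "\<tau> \<le> \<tau> * e" using \<tau> e mult_left_mono[of 1 e \<tau>] by simp
  have \<mu>k: "\<mu> \<le> ?k" using t by (intro order_trans[OF \<mu>b b_le]) simp
  \<comment> \<open>On each side of the cut one of \<open>b i\<close>, \<open>c' (Suc i)\<close> is
    at least \<open>\<mu>\<close> and the other at most \<open>\<tau>\<close>; the summand
    \<open>\<tau>\<close> covers negative \<open>m i\<close>.\<close>
  have "\<bar>m i\<bar> \<le> ?k - \<mu> + \<tau>"
  proof (cases "i < t")
    case True
    then have "\<mu> \<le> real (b i)"
      using t by (intro order_trans[OF \<mu>b]) (simp add: b_antimono)
    moreover have "c' (Suc i) \<le> \<tau>" using c_small True by simp
    moreover have "0 \<le> c' (Suc i)" by (rule c_nonneg)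
    ultimately show ?thesis using b_le[of i] i \<mu>k unfolding m_def by linarith
  next
    case False
    then have "\<mu> \<le> c' (Suc i)" using \<mu>c c_mono[of "Suc t" "Suc i"] i by (simp add: c'_def)
    moreover have "real (b i) \<le> \<tau>" using b_small False i by simp
    moreover have "0 \<le> real (b i)" by simp
    ultimately show ?thesis using c_le[of "Suc i"] i \<mu>k unfolding m_def by linarith
  qed
  then show ?thesis using i(2) \<tau>e by linarith
qed


section \<open>Explicit constants and the passage to the spectral radius\<close>

lemma separated_eigenvalue_bound:
  fixes x :: "nat \<Rightarrow> real" and H \<epsilon> :: real
  assumes d: "d \<ge> 2" and H: "H = real d powr (1 + log 2 (real d))"
    and \<epsilon>: "0 < \<epsilon>" "\<epsilon> * (200 * (real d)\<^sup>2 * H) ^ 3 \<le> 1"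
    and sep: "\<And>i. i < d \<Longrightarrow> real (b i) < \<epsilon> * real (b 0) \<or> real (c (Suc i)) < \<epsilon> * real (b 0)"
    and eig: "\<And>v. v < n \<Longrightarrow> (\<Sum>w | w < n \<and> E v w. x w) = \<theta> * x v + s"
    and nonconst: "\<exists>v<n. x v \<noteq> x 0"
  shows "\<bar>\<theta>\<bar> \<le> real (b 0) * (1 - 1 / (4 * H))"
proof -
  let ?k = "real (b 0)"
  \<comment> \<open>Chosen so that \<open>1 / (C - 2) = 1 / (16 * d)\<close>: at most
    \<open>d\<close> halvings then lose only a factor 15/16 in total.\<close>
  define C :: real where "C = 16 * real d + 2"
  have k: "?k > 0" using b_pos[of 0] d by simp
  have d2: "real d \<ge> 2" using d by simp
  have "1 \<le> log 2 (real d)" using d2 by (simp add: le_log_iff)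
  then have "real d powr 1 \<le> H" unfolding H using d2 by (intro powr_mono) auto
  then have Hd: "real d \<le> H" using d2 by simp
  have C: "C \<ge> 3" "C \<le> 17 * real d" using d2 by (auto simp: C_def)
  \<comment> \<open>Up to numerical factors \<open>X\<close> dominates the error terms. The bound
    \<open>8000000 * X \<le> 1\<close> comes from \<open>200 ^ 3 = 8000000\<close> and the spare
    factor \<open>d ^ 4 * H \<ge> 1\<close> in the hypothesis.\<close>
  define X where "X = \<epsilon> * (real d)\<^sup>2 * H\<^sup>2"
  have X: "8000000 * X \<le> 1"
  proof -
    have "1 * 1 \<le> real d ^ 4 * H" using d2 Hd by (intro mult_mono one_le_power) auto
    then have "8000000 * X * 1 \<le> 8000000 * X * (real d ^ 4 * H)"
      using \<epsilon> by (intro mult_left_mono) (auto simp: X_def)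
    also have "\<dots> = \<epsilon> * (200 * (real d)\<^sup>2 * H) ^ 3"
      by (simp add: X_def power_mult_distrib power2_eq_square power3_eq_cube power4_eq_xxxx mult_ac)
    finally show ?thesis using \<epsilon> by simp
  qed
  have X_bounds: "\<epsilon> * real d * H\<^sup>2 \<le> X" "\<epsilon> * (real d)\<^sup>2 \<le> X" "\<epsilon> * real d \<le> X" "\<epsilon> \<le> X"
  proof -
    have H1: "1 \<le> H\<^sup>2" using Hd d2 by (intro one_le_power) auto
    have "\<epsilon> * real d * H\<^sup>2 * 1 \<le> \<epsilon> * real d * H\<^sup>2 * real d"
      using d2 \<epsilon> by (intro mult_left_mono) auto
    then show 1: "\<epsilon> * real d * H\<^sup>2 \<le> X" by (simp add: X_def power2_eq_square mult_ac)
    have "\<epsilon> * (real d)\<^sup>2 * 1 \<le> X" unfolding X_def using H1 \<epsilon> by (intro mult_left_mono) auto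
    then show "\<epsilon> * (real d)\<^sup>2 \<le> X" by simp
    have "\<epsilon> * real d * 1 \<le> \<epsilon> * real d * H\<^sup>2" using H1 \<epsilon> by (intro mult_left_mono) auto
    then show 2: "\<epsilon> * real d \<le> X" using 1 by simp
    have "\<epsilon> * 1 \<le> \<epsilon> * real d" using d2 \<epsilon> by (intro mult_left_mono) auto
    then show "\<epsilon> \<le> X" using 2 by simp
  qed
  have \<epsilon>C: "\<epsilon> * C \<le> 17 * X"
  proof -
    have "\<epsilon> * C \<le> \<epsilon> * (17 * real d)" using C \<epsilon> by (intro mult_left_mono) auto
    then show ?thesis using X_bounds by simp
  qed
  \<comment> \<open>The cut is placed right after the largest index in \<open>J\<close>;
    monotonicity of \<open>b\<close> and \<open>c\<close> extends the ratio to all smaller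
    indices.\<close>
  define J where "J = {j. j < d \<and> real (b j) \<ge> C * real (c (Suc j))}"
  have "0 \<in> J"
  proof (rule ccontr)
    assume "0 \<notin> J"
    then have kC: "?k < C * real (c (Suc 0))" using d by (simp add: J_def)
    have "?k < \<epsilon> * ?k \<or> real (c (Suc 0)) < \<epsilon> * ?k" using sep[of 0] d by simp
    moreover have "\<not> ?k < \<epsilon> * ?k" using k X X_bounds(4) \<epsilon> by simp
    ultimately have "real (c (Suc 0)) < \<epsilon> * ?k" by blast
    also have "\<dots> < \<epsilon> * (C * real (c (Suc 0)))" using kC \<epsilon> by simp
    also have "\<dots> = (\<epsilon> * C) * real (c (Suc 0))" by simp
    also have "\<dots> \<le> 1 * real (c (Suc 0))" using \<epsilon>C X by (intro mult_right_mono) auto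
    finally show False by simp
  qed
  define j where "j = Max J"
  have "finite J" by (simp add: J_def)
  then have jJ: "j \<in> J" and j_max: "\<And>i. i \<in> J \<Longrightarrow> i \<le> j"
    unfolding j_def using \<open>0 \<in> J\<close> by (auto intro: Max_in)
  then have j: "j < d" "real (b j) \<ge> C * real (c (Suc j))" by (auto simp: J_def)
  have ratio: "real (b i) \<ge> C * real (c (Suc i))" if "i \<le> j" for i
  proof -
    have "C * real (c (Suc i)) \<le> C * real (c (Suc j))"
      using c_mono[of "Suc i" "Suc j"] that j C by (intro mult_left_mono) auto
    also have "\<dots> \<le> real (b j)" by (rule j)
    also have "\<dots> \<le> real (b i)" using b_antimono[of i j] that j by simp
    finally show ?thesis .
  qed
  \<comment> \<open>With \<open>m\<close> the integer part of \<open>log 2 d\<close>, the halving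
    bound has \<open>d ^ m \<le> H / d\<close>, and Bernoulli's inequality gives the factor
    15/16.\<close>
  have bj: "real (b j) \<ge> 15 / 32 * real d / H * ?k"
  proof -
    obtain m where m: "2 ^ m \<le> d" "d < 2 ^ (m + 1)"
      using ex_power_ivl1[of 2 d] d by auto
    have "Suc m \<le> d" by (intro Suc_leI less_le_trans[OF less_exp m(1)])
    then have mfrac: "real (Suc m) / (16 * real d) \<le> 1 / 16"
      using d2 by (simp add: field_simps)
    have "15 / 16 \<le> 1 + real (Suc m) * (- (1 / (16 * real d)))" using mfrac by simp
    also have "\<dots> \<le> (1 + - (1 / (16 * real d))) ^ Suc m"
      using d2 by (intro Bernoulli_inequality) (simp add: field_simps)
    finally have q: "15 / 16 \<le> (1 - 1 / (C - 2)) ^ Suc m" by (simp add: C_def)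
    have "real d ^ m = real d powr real m" using d2 by (simp add: powr_realpow)
    also have "\<dots> \<le> real d powr log 2 (real d)"
      using d2 le_log2_of_power[OF m(1)] by (intro powr_mono) auto
    also have "\<dots> = H / real d" unfolding H using d2 by (simp add: powr_add)
    finally have "real d ^ m \<le> H / real d" .
    then have den: "2 * real d ^ m \<le> 2 * H / real d" by simp
    have "15 / 32 * real d / H * ?k = (15 / 16 * ?k) / (2 * H / real d)" by simp
    also have "\<dots> \<le> (15 / 16 * ?k) / (2 * real d ^ m)"
      using den d2 k Hd by (intro divide_left_mono mult_pos_pos) auto
    also have "\<dots> \<le> ((1 - 1 / (C - 2)) ^ Suc m * ?k) / (2 * real d ^ m)"
      using q k d2 by (intro divide_right_mono mult_right_mono) auto
    also have "\<dots> \<le> real (b j)"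
      using d C m j ratio by (intro b_lower_bound) auto
    finally show ?thesis .
  qed
  have "1 / H * ?k * (15 / 32) \<le> 15 / 32 * real d / H * ?k"
    using d2 Hd k by (simp add: field_simps)
  then have bj1: "real (b j) \<ge> 15 / 32 / H * ?k" using bj by simp
  have \<epsilon>H: "\<epsilon> \<le> 15 / 32 / H"
  proof -
    have "\<epsilon> * H * 1 \<le> \<epsilon> * H * (real d * H)"
      using \<epsilon> Hd d2 by (intro mult_left_mono) (auto intro: order_trans[OF _ mult_mono[of 1 _ 1]])
    also have "\<dots> = \<epsilon> * real d * H\<^sup>2" by (simp add: power2_eq_square mult_ac)
    finally have "\<epsilon> * H \<le> 15 / 32" using X X_bounds by simp
    then show ?thesis using Hd d2 by (simp add: field_simps)
  qed
  define t where "t = Suc j"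
  \<comment> \<open>Since \<open>b (t - 1)\<close> is large, separation makes \<open>c t\<close>
    small. As \<open>t\<close> is not in \<open>J\<close>, also \<open>b t < C * c (Suc t)\<close>,
    so either case of separation at \<open>t\<close> bounds \<open>b t\<close> by
    \<open>\<tau>\<close>.\<close>
  define \<tau> where "\<tau> = \<epsilon> * C * ?k"
  have t: "1 \<le> t" "t \<le> d" using j by (auto simp: t_def)
  have "\<epsilon> * ?k \<le> real (b j)"
    using mult_right_mono[OF \<epsilon>H, of ?k] k bj1 by linarith
  then have ct0: "real (c t) < \<epsilon> * ?k" using sep[OF j(1)] by (auto simp: t_def)
  have "\<epsilon> * 1 * ?k \<le> \<tau>" unfolding \<tau>_def using C \<epsilon> k by (intro mult_right_mono mult_left_mono) auto
  then have \<epsilon>\<tau>: "\<epsilon> * ?k \<le> \<tau>" by simp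
  have ct: "real (c t) \<le> \<tau>" using ct0 \<epsilon>\<tau> by simp
  have bt: "real (b t) \<le> \<tau>"
  proof (cases "t < d")
    case False
    then have "t = d" using t by simp
    then show ?thesis using b_diameter \<epsilon>\<tau> k \<epsilon> by (simp add: order_trans[OF _ \<epsilon>\<tau>])
  next
    case True
    then have "t \<notin> J" using j_max[of t] by (auto simp: t_def)
    then have lt: "real (b t) < C * real (c (Suc t))" using True by (simp add: J_def)
    from sep[OF True] show ?thesis
    proof
      assume "real (b t) < \<epsilon> * ?k" then show ?thesis using \<epsilon>\<tau> by simp
    next
      assume "real (c (Suc t)) < \<epsilon> * ?k"
      then have "C * real (c (Suc t)) \<le> C * (\<epsilon> * ?k)" using C by (intro mult_left_mono) auto
      then show ?thesis using lt by (simp add: \<tau>_def mult_ac)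
    qed
  qed
  \<comment> \<open>The factor 2/5 lies below 9/10 times 15/32, what remains for
    \<open>c (Suc t)\<close>; the division by \<open>t \<le> d\<close> there is absorbed by the
    factor \<open>d\<close> in \<open>bj\<close>.\<close>
  define \<mu> where "\<mu> = 2 / 5 / H * ?k"
  have \<mu>b: "\<mu> \<le> real (b (t - 1))"
  proof -
    have "2 / 5 / H * ?k \<le> 15 / 32 / H * ?k" using Hd d2 k by (intro mult_right_mono divide_right_mono) auto
    then show ?thesis using bj1 by (simp add: \<mu>_def t_def)
  qed
  have \<mu>c: "\<mu> \<le> real (c (Suc t))" if "t < d"
  proof -
    have td: "real (Suc t) \<le> real d" using that by simp
    have "real (Suc t) * (real (b t) + real (c t)) \<le> real d * (\<tau> + \<tau>)"
      using td bt ct by (intro mult_mono add_mono) auto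
    also have "\<dots> = (2 * real d * (\<epsilon> * C)) * ?k" by (simp add: \<tau>_def)
    also have "\<dots> \<le> (1 / 10) * ?k"
    proof (rule mult_right_mono)
      have "2 * real d * (\<epsilon> * C) \<le> 2 * real d * (\<epsilon> * (17 * real d))"
        using C \<epsilon> by (intro mult_left_mono) auto
      also have "\<dots> = 34 * (\<epsilon> * (real d)\<^sup>2)" by (simp add: power2_eq_square)
      also have "\<dots> \<le> 1 / 10" using X_bounds(2) X by simp
      finally show "2 * real d * (\<epsilon> * C) \<le> 1 / 10" .
    qed (use k in simp)
    finally have "real (Suc t) * (real (b t) + real (c t)) / ?k \<le> 1 / 10"
      using k by (simp only: pos_divide_le_eq)
    then have frac: "9 / 10 \<le> 1 - real (Suc t) * (real (b t) + real (c t)) / ?k" by linarith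
    have "\<mu> \<le> 9 / 10 * (15 / 32 / H * ?k)"
      using Hd d2 k by (simp add: \<mu>_def field_simps)
    also have "\<dots> = 9 / 10 * (15 / 32 * real d / H * ?k) / real d" using d2 by simp
    also have "\<dots> \<le> 9 / 10 * real (b (t - 1)) / real t"
      using bj td t by (intro frac_le mult_left_mono) (auto simp: t_def)
    also have "\<dots> \<le> (1 - real (Suc t) * (real (b t) + real (c t)) / ?k) * real (b (t - 1)) / real t"
      using frac by (intro divide_right_mono mult_right_mono) auto
    also have "\<dots> \<le> real (c (Suc t))" using t that by (intro c_lower_bound) auto
    finally show ?thesis .
  qed
  \<comment> \<open>With \<open>e = 40 * H\<close> the terms add up, in units of
    \<open>k / H\<close>, to \<open>- 2/5 + 1/8 + 1/40 = - 1/4\<close>.\<close>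
  have "\<bar>\<theta>\<bar> \<le> ?k - \<mu> + 3 * \<tau> * (40 * H) + ?k / (40 * H)"
    using Hd d2 \<mu>c by (intro eigenvalue_bound[OF eig nonconst t _ ct bt \<mu>b]) auto
  also have "3 * \<tau> * (40 * H) \<le> 1 / (8 * H) * ?k"
  proof -
    have "120 * (\<epsilon> * C) * H * H \<le> 120 * (\<epsilon> * (17 * real d)) * H * H"
      using C \<epsilon> Hd d2 by (intro mult_right_mono mult_left_mono) auto
    also have "\<dots> = 2040 * (\<epsilon> * real d * H\<^sup>2)" by (simp add: power2_eq_square)
    also have "\<dots> \<le> 1 / 8" using X X_bounds by simp
    finally have "120 * (\<epsilon> * C) * H \<le> 1 / 8 / H" using Hd d2 by (simp only: pos_le_divide_eq)
    then have "120 * (\<epsilon> * C) * H * ?k \<le> 1 / 8 / H * ?k" using k by (intro mult_right_mono) auto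
    then show ?thesis by (simp add: \<tau>_def mult_ac)
  qed
  also have "?k - \<mu> + 1 / (8 * H) * ?k + ?k / (40 * H) = ?k * (1 - 1 / (4 * H))"
    using Hd d2 by (simp add: \<mu>_def field_simps)
  finally show ?thesis by simp
qed

text \<open>Deflation identifies the eigenvalues left after removing one \<open>k\<close> with the
  roots of \<open>q\<close>; each root yields an \<open>x\<close> to which \<open>bound\<close>
  applies.\<close>

lemma zero_weight_spectral_radius_le:
  fixes B :: real
  assumes "d \<ge> 1"
    and bound: "\<And>x \<theta> s. (\<And>v. v < n \<Longrightarrow> (\<Sum>w | w < n \<and> E v w. x w) = \<theta> * x v + s) \<Longrightarrow>
        \<exists>v<n. x v \<noteq> x 0 \<Longrightarrow> \<bar>\<theta>\<bar> \<le> B"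
  shows "zero_weight_spectral_radius n E (b 0) \<le> B"
proof -
  obtain m where m: "n = Suc m" using n_pos by (cases n) auto
  have "m > 0"
  proof (rule ccontr)
    assume "\<not> m > 0"
    then have "u = v" if "u < n" "v < n" for u v using that m by simp
    moreover obtain u v where "u < n" "v < n" "dst u v = d" using pair_at_distance[of d] by blast
    ultimately show False using assms(1) dst_self[of u] by fastforce
  qed
  define F :: "nat \<Rightarrow> nat \<Rightarrow> real" where "F i j = (if E i j then 1 else 0)" for i j
  have F_sum: "(\<Sum>w<n. F v w * x w) = (\<Sum>w | w < n \<and> E v w. x w)" for v x
  proof -
    have "(\<Sum>w<n. F v w * x w) = (\<Sum>w<n. if E v w then x w else 0)"
      by (intro sum.cong) (auto simp: F_def)
    also have "\<dots> = (\<Sum>w | w < n \<and> E v w. x w)"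
      by (simp add: sum.If_cases Int_def)
    finally show ?thesis .
  qed
  define q where "q = char_poly (mat m m (\<lambda>(i, j). F (Suc i) (Suc j) - F 0 (Suc j)))"
  have A: "adj_matrix n E = mat n n (\<lambda>(i, j). F i j)"
    by (simp add: adj_matrix_def F_def)
  have "(\<Sum>j<Suc m. F i j) = real (b 0)" if "i < Suc m" for i
    using F_sum[of i "\<lambda>_. 1"] degree[of i] that m by simp
  then have cp: "char_poly (adj_matrix n E) = [:- real (b 0), 1:] * q"
    unfolding A unfolding q_def m by (rule char_poly_deflate)
  have q: "degree q = m" "q \<noteq> 0"
    using degree_monic_char_poly[of "mat m m (\<lambda>(i, j). F (Suc i) (Suc j) - F 0 (Suc j))" m]
    by (auto simp: q_def)
  have ev: "adj_eigenvalues n E - {# real (b 0) #} = proots q"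
    unfolding adj_eigenvalues_def cp using q by (subst proots_mult) auto
  \<comment> \<open>The maximum is taken over a nonempty set: \<open>d \<ge> 1\<close> gives at
    least two vertices, so \<open>q\<close> has positive degree.\<close>
  obtain \<theta>\<^sub>0 where "poly q \<theta>\<^sub>0 = 0"
  proof (rule symmetric_char_poly_factor_has_root[of n F q])
    show "F i j = F j i" for i j using edge_commute by (simp add: F_def)
    show "q dvd char_poly (mat n n (\<lambda>(i, j). F i j))"
      unfolding A[symmetric] cp by (rule dvd_triv_right)
    show "degree q > 0" using q \<open>m > 0\<close> by simp
  qed
  then have ne: "set_mset (proots q) \<noteq> {}" using q by auto
  have "\<bar>\<theta>\<bar> \<le> B" if "\<theta> \<in> set_mset (proots q)" for \<theta>
  proof -
    have "poly q \<theta> = 0" using that q by simp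
    then obtain x s where "\<exists>v<Suc m. x v \<noteq> x 0" "\<And>v. v < Suc m \<Longrightarrow> (\<Sum>w<Suc m. F v w * x w) = \<theta> * x v + s"
      unfolding q_def by (rule deflated_eigenvector) (rule that, assumption, assumption)
    then show ?thesis using bound[of x \<theta> s] F_sum m by simp
  qed
  then show ?thesis
    unfolding zero_weight_spectral_radius_def ev using ne by (subst Max_le_iff) auto
qed

end

theorem theorem3:
  fixes d :: nat
  assumes "d \<ge> 2"
  shows "\<exists>\<epsilon>::real. \<exists>\<eta>::real. \<epsilon> > 0 \<and> \<eta> > 0 \<and>
     \<epsilon> = 200 powr (- real (d + 1)) * real d powr (- (real (d + 1) * (log 2 (real d) + 3))) \<and>
     \<eta> = 1 / 4 * real d powr (- (1 + log 2 (real d))) \<and>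
     (\<forall>n E a b c. distance_regular n E d a b c \<longrightarrow>
        (\<exists>i<d. real (b i) \<ge> \<epsilon> * real (b 0) \<and> real (c (i + 1)) \<ge> \<epsilon> * real (b 0)) \<or>
        zero_weight_spectral_radius n E (b 0) \<le> real (b 0) * (1 - \<eta>))"
proof -
  have d2: "real d \<ge> 2" using assms by simp
  define H where "H = real d powr (1 + log 2 (real d))"
  \<comment> \<open>\<open>R\<close> is the base for which
    \<open>\<epsilon> = R powr - (d + 1)\<close>; since \<open>d + 1 \<ge> 3\<close>, this gives
    \<open>\<epsilon> * R ^ 3 \<le> 1\<close>.\<close>
  define R where "R = 200 * (real d)\<^sup>2 * H"
  define \<epsilon> where "\<epsilon> = 200 powr (- real (d + 1)) * real d powr (- (real (d + 1) * (log 2 (real d) + 3)))"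
  define \<eta> where "\<eta> = 1 / 4 * real d powr (- (1 + log 2 (real d)))"
  have pos: "\<epsilon> > 0" "\<eta> > 0" using d2 by (auto simp: \<epsilon>_def \<eta>_def)
  have \<eta>: "\<eta> = 1 / (4 * H)" unfolding \<eta>_def H_def powr_minus by (simp add: field_simps)
  have R: "R = 200 * real d powr (log 2 (real d) + 3)"
  proof -
    have "real d powr (log 2 (real d) + 3) = real d powr (2 + (1 + log 2 (real d)))"
      by (rule arg_cong[where f = "\<lambda>z. real d powr z"]) simp
    also have "\<dots> = (real d)\<^sup>2 * H" unfolding H_def using d2 by (subst powr_add) simp
    finally show ?thesis by (simp add: R_def)
  qed
  have "1 \<le> real d powr (log 2 (real d) + 3)"
    using d2 by (intro ge_one_powr_ge_zero) auto
  then have R1: "R \<ge> 1" unfolding R by simp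
  have "(log 2 (real d) + 3) * - real (d + 1) = - (real (d + 1) * (log 2 (real d) + 3))"
    by (simp only: mult_minus_right mult.commute)
  then have "\<epsilon> = R powr (- real (d + 1))"
    unfolding \<epsilon>_def R by (simp only: powr_mult powr_powr powr_ge_zero zero_le_numeral)
  also have "\<dots> \<le> R powr (- 3)" using R1 assms by (intro powr_mono) auto
  finally have "\<epsilon> * R ^ 3 \<le> R powr (- 3) * R powr 3"
    using R1 by (intro mult_mono) auto
  also have "\<dots> = 1" using R1 by (simp add: powr_minus)
  finally have \<epsilon>R: "\<epsilon> * (200 * (real d)\<^sup>2 * H) ^ 3 \<le> 1" by (simp add: R_def)
  have "(\<exists>i<d. real (b i) \<ge> \<epsilon> * real (b 0) \<and> real (c (i + 1)) \<ge> \<epsilon> * real (b 0)) \<or>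
        zero_weight_spectral_radius n E (b 0) \<le> real (b 0) * (1 - \<eta>)"
    if "distance_regular n E d a b c" for n E a b c
  proof (rule disjCI)
    interpret distance_regular_graph n E d a b c by standard (rule that)
    assume gap: "\<not> zero_weight_spectral_radius n E (b 0) \<le> real (b 0) * (1 - \<eta>)"
    show "\<exists>i<d. real (b i) \<ge> \<epsilon> * real (b 0) \<and> real (c (i + 1)) \<ge> \<epsilon> * real (b 0)"
    proof (rule ccontr)
      assume "\<not> ?thesis"
      then have sep: "real (b i) < \<epsilon> * real (b 0) \<or> real (c (Suc i)) < \<epsilon> * real (b 0)" if "i < d" for i
        using that by (auto simp: not_le)
      have "zero_weight_spectral_radius n E (b 0) \<le> real (b 0) * (1 - \<eta>)"
      proof (rule zero_weight_spectral_radius_le)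
        show "1 \<le> d" using assms by simp
        show "\<bar>\<theta>\<bar> \<le> real (b 0) * (1 - \<eta>)"
          if "\<And>v. v < n \<Longrightarrow> (\<Sum>w | w < n \<and> E v w. x w) = \<theta> * x v + s" "\<exists>v<n. x v \<noteq> x 0" for x \<theta> s
          unfolding \<eta> by (rule separated_eigenvalue_bound[OF assms H_def pos(1) \<epsilon>R sep that])
      qed
      then show False using gap by blast
    qed
  qed
  then show ?thesis using pos \<epsilon>_def \<eta>_def by blast
qed

end
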